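(* The adversarial recoverable selection problem \textsc{AREC} under the continuous budgeted uncertainty set $\mathcal{U}^c$, i.e. the problem, for a given $\mathbf{x}\in\Phi$, $$\max_{\mathbf{c}\in\mathcal{U}^c}\ \min_{\mathbf{y}\in\Phi^k_{\mathbf{x}}}\mathbf{c}\mathbf{y},$$ can be solved in $O(n^2)$ time.
   Context: Let $[n]=\{1,\dots,n\}$ and $p\in[n]$. The input consists of $n$, $p$, a recovery parameter $k\in[p]\cup\{0\}$, a vector $\mathbf{x}\in\Phi$, nonnegative item costs $\underline{c}_i\le\overline{c}_i$ with $d_i=\overline{c}_i-\underline{c}_i\ge 0$ for $i\in[n]$, and a budget $\Gamma\ge 0$. Products such as $\mathbf{c}\mathbf{y}$ denote $\sum_{i\in[n]}c_iy_i$. $\Phi=\{\mathbf{x}\in\{0,1\}^n:\sum_{i\in[n]}x_i=p\}$. For $\mathbf{x}\in\Phi$, $\Phi^k_{\mathbf{x}}=\{\mathbf{y}\in\{0,1\}^n:\sum_{i\in[n]}y_i=p,\ \sum_{i\in[n]}x_iy_i\ge p-k\}$. The continuous budgeted uncertainty set is $\mathcal{U}^c=\{(\underline{c}_i+\delta_i)_{i\in[n]}:\delta_i\in[0,d_i],\ \sum_{i\in[n]}\delta_i\le\Gamma\}$. Running time counts elementary arithmetic operations and comparisons on the input numbers (standard unit-cost model). *)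

theory Defs
  imports Complex_Main "HOL-Library.FuncSet" "HOL-Library.Landau_Symbols"
begin

section \<open>The adversarial recoverable selection problem\<close>

text \<open>Vectors indexed by \<open>[n]\<close> are functions on \<open>nat\<close> that are extensional on
  \<open>{1..n}\<close>, so the sets below contain each vector exactly once.\<close>

definition Phi :: "nat \<Rightarrow> nat \<Rightarrow> (nat \<Rightarrow> nat) set" where
  "Phi n p = {x \<in> {1..n} \<rightarrow>\<^sub>E {0, 1}. (\<Sum>i=1..n. x i) = p}"

text \<open>The subtraction is only used for \<open>k \<le> p\<close>, where it does not truncate.\<close>

definition Phi_rec :: "nat \<Rightarrow> nat \<Rightarrow> nat \<Rightarrow> (nat \<Rightarrow> nat) \<Rightarrow> (nat \<Rightarrow> nat) set" where
  "Phi_rec n p k x =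
     {y \<in> {1..n} \<rightarrow>\<^sub>E {0, 1}. (\<Sum>i=1..n. y i) = p \<and> (\<Sum>i=1..n. x i * y i) \<ge> p - k}"

definition scenarios ::
    "nat \<Rightarrow> (nat \<Rightarrow> real) \<Rightarrow> (nat \<Rightarrow> real) \<Rightarrow> real \<Rightarrow> (nat \<Rightarrow> real) set" where
  "scenarios n clo chi \<Gamma> =
     {(\<lambda>i\<in>{1..n}. clo i + \<delta> i) | \<delta>.
        (\<forall>i\<in>{1..n}. \<delta> i \<in> {0..chi i - clo i}) \<and> (\<Sum>i=1..n. \<delta> i) \<le> \<Gamma>}"

definition recovery_cost ::
    "nat \<Rightarrow> nat \<Rightarrow> nat \<Rightarrow> (nat \<Rightarrow> nat) \<Rightarrow> (nat \<Rightarrow> real) \<Rightarrow> real" where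
  "recovery_cost n p k x c =
     Min ((\<lambda>y. \<Sum>i=1..n. c i * real (y i)) ` Phi_rec n p k x)"

definition arec_instance ::
    "nat \<Rightarrow> nat \<Rightarrow> nat \<Rightarrow> (nat \<Rightarrow> nat) \<Rightarrow> (nat \<Rightarrow> real) \<Rightarrow> (nat \<Rightarrow> real) \<Rightarrow> real \<Rightarrow> bool" where
  "arec_instance n p k x clo chi \<Gamma> \<longleftrightarrow>
     p \<in> {1..n} \<and> k \<le> p \<and> x \<in> Phi n p \<and>
     (\<forall>i\<in>{1..n}. 0 \<le> clo i \<and> clo i \<le> chi i) \<and> 0 \<le> \<Gamma>"

text \<open>An optimal solution of the max-min problem is a worst-case scenario \<open>c\<close> together with
  the optimal value \<open>v\<close>.\<close>

definition arec_solution ::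
    "nat \<Rightarrow> nat \<Rightarrow> nat \<Rightarrow> (nat \<Rightarrow> nat) \<Rightarrow> (nat \<Rightarrow> real) \<Rightarrow> (nat \<Rightarrow> real) \<Rightarrow> real \<Rightarrow>
     (nat \<Rightarrow> real) \<Rightarrow> real \<Rightarrow> bool" where
  "arec_solution n p k x clo chi \<Gamma> c v \<longleftrightarrow>
     is_arg_max (recovery_cost n p k x) (\<lambda>c. c \<in> scenarios n clo chi \<Gamma>) c \<and>
     v = recovery_cost n p k x c"

lemma finite_Phi_rec: "finite (Phi_rec n p k x)"
proof (rule finite_subset)
  show "Phi_rec n p k x \<subseteq> {1..n} \<rightarrow>\<^sub>E {0, 1}"
    by (auto simp: Phi_rec_def)
qed (intro finite_PiE; simp)

lemma mem_Phi_rec: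
  assumes "x \<in> Phi n p"
  shows "x \<in> Phi_rec n p k x"
proof -
  have "x i * x i = x i" if "i \<in> {1..n}" for i
    using PiE_mem[of x "{1..n}" "\<lambda>_. {0, 1}" i] that assms by (auto simp: Phi_def)
  then have "(\<Sum>i=1..n. x i * x i) = (\<Sum>i=1..n. x i)"
    by (intro sum.cong) auto
  with assms show ?thesis
    by (auto simp: Phi_def Phi_rec_def)
qed


section \<open>Unit-cost programs over natural and real numbers\<close>

text \<open>
  A uniform real random access machine, presented as a while language. Memory consists of
  named arrays of naturals and named arrays of reals; scalars are cells with index \<open>0\<close>.
  A program is a fixed finite term. There are no operations that convert reals to naturals, and
  real constants can be introduced only through naturals, so that a program cannot
  carry arbitrary real constants as advice. Division by zero yields \<open>0\<close>, which a program
  could equally obtain by one additional comparison.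
\<close>

type_synonym name = string

record state =
  nmem :: "name \<Rightarrow> nat \<Rightarrow> nat"
  rmem :: "name \<Rightarrow> nat \<Rightarrow> real"

datatype nexp = NConst nat | NLoad name nexp | NAdd nexp nexp | NSub nexp nexp

datatype rexp =
    RNat nexp | RLoad name nexp
  | RAdd rexp rexp | RSub rexp rexp | RMul rexp rexp | RDiv rexp rexp

datatype bexp = NLess nexp nexp | RLess rexp rexp | BNot bexp | BAnd bexp bexp

datatype com =
    Skip
  | NStore name nexp nexp
  | RStore name nexp rexp
  | Seq com com
  | If bexp com com
  | While bexp com

fun nval :: "nexp \<Rightarrow> state \<Rightarrow> nat" where
  "nval (NConst m) s = m"
| "nval (NLoad a e) s = nmem s a (nval e s)"
| "nval (NAdd e f) s = nval e s + nval f s"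
| "nval (NSub e f) s = nval e s - nval f s"

fun rval :: "rexp \<Rightarrow> state \<Rightarrow> real" where
  "rval (RNat e) s = real (nval e s)"
| "rval (RLoad a e) s = rmem s a (nval e s)"
| "rval (RAdd e f) s = rval e s + rval f s"
| "rval (RSub e f) s = rval e s - rval f s"
| "rval (RMul e f) s = rval e s * rval f s"
| "rval (RDiv e f) s = rval e s / rval f s"

fun bval :: "bexp \<Rightarrow> state \<Rightarrow> bool" where
  "bval (NLess e f) s \<longleftrightarrow> nval e s < nval f s"
| "bval (RLess e f) s \<longleftrightarrow> rval e s < rval f s"
| "bval (BNot b) s \<longleftrightarrow> \<not> bval b s"
| "bval (BAnd b b') s \<longleftrightarrow> bval b s \<and> bval b' s"

text \<open>Every constant, memory access, arithmetic operation, comparison and Boolean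
  connective costs one time unit.\<close>

fun ncost :: "nexp \<Rightarrow> nat" where
  "ncost (NConst m) = 1"
| "ncost (NLoad a e) = 1 + ncost e"
| "ncost (NAdd e f) = 1 + ncost e + ncost f"
| "ncost (NSub e f) = 1 + ncost e + ncost f"

fun rcost :: "rexp \<Rightarrow> nat" where
  "rcost (RNat e) = 1 + ncost e"
| "rcost (RLoad a e) = 1 + ncost e"
| "rcost (RAdd e f) = 1 + rcost e + rcost f"
| "rcost (RSub e f) = 1 + rcost e + rcost f"
| "rcost (RMul e f) = 1 + rcost e + rcost f"
| "rcost (RDiv e f) = 1 + rcost e + rcost f"

fun bcost :: "bexp \<Rightarrow> nat" where
  "bcost (NLess e f) = 1 + ncost e + ncost f"
| "bcost (RLess e f) = 1 + rcost e + rcost f"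
| "bcost (BNot b) = 1 + bcost b"
| "bcost (BAnd b b') = 1 + bcost b + bcost b'"

definition nwrite :: "name \<Rightarrow> nat \<Rightarrow> nat \<Rightarrow> state \<Rightarrow> state" where
  "nwrite a i m s = s\<lparr>nmem := (nmem s)(a := (nmem s a)(i := m))\<rparr>"

definition rwrite :: "name \<Rightarrow> nat \<Rightarrow> real \<Rightarrow> state \<Rightarrow> state" where
  "rwrite a i r s = s\<lparr>rmem := (rmem s)(a := (rmem s a)(i := r))\<rparr>"

text \<open>\<open>exec c s t s'\<close>: started in state \<open>s\<close>, command \<open>c\<close> terminates in state \<open>s'\<close> after
  exactly \<open>t\<close> time units.\<close>

inductive exec :: "com \<Rightarrow> state \<Rightarrow> nat \<Rightarrow> state \<Rightarrow> bool" where
  Skip: "exec Skip s 1 s"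
| NStore: "exec (NStore a i e) s (1 + ncost i + ncost e) (nwrite a (nval i s) (nval e s) s)"
| RStore: "exec (RStore a i e) s (1 + ncost i + rcost e) (rwrite a (nval i s) (rval e s) s)"
| Seq: "exec c s t s' \<Longrightarrow> exec c' s' t' s'' \<Longrightarrow> exec (Seq c c') s (t + t') s''"
| IfTrue: "bval b s \<Longrightarrow> exec c s t s' \<Longrightarrow> exec (If b c c') s (bcost b + t) s'"
| IfFalse: "\<not> bval b s \<Longrightarrow> exec c' s t s' \<Longrightarrow> exec (If b c c') s (bcost b + t) s'"
| WhileFalse: "\<not> bval b s \<Longrightarrow> exec (While b c) s (bcost b) s"
| WhileTrue: "bval b s \<Longrightarrow> exec c s t s' \<Longrightarrow> exec (While b c) s' t' s'' \<Longrightarrow>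
    exec (While b c) s (bcost b + t + t') s''"

inductive_cases SkipE: "exec Skip s t s'"
inductive_cases NStoreE: "exec (NStore a i e) s t s'"
inductive_cases RStoreE: "exec (RStore a i e) s t s'"
inductive_cases SeqE: "exec (Seq c c') s t s'"
inductive_cases IfE: "exec (If b c c') s t s'"
inductive_cases WhileE: "exec (While b c) s t s'"

lemma exec_deterministic:
  "exec c s t s' \<Longrightarrow> exec c s u r \<Longrightarrow> u = t \<and> r = s'"
proof (induction arbitrary: u r rule: exec.induct)
  case Skip then show ?case by (auto elim: SkipE)
next
  case NStore then show ?case by (auto elim: NStoreE)
next
  case RStore then show ?case by (auto elim: RStoreE)
next
  case Seq from Seq.prems show ?case by (rule SeqE) (use Seq.IH in blast)
next
  case IfTrue from IfTrue.prems show ?case by (rule IfE) (use IfTrue in blast)+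
next
  case IfFalse from IfFalse.prems show ?case by (rule IfE) (use IfFalse in blast)+
next
  case WhileFalse from WhileFalse.prems show ?case by (rule WhileE) (use WhileFalse in auto)
next
  case WhileTrue from WhileTrue.prems show ?case by (rule WhileE) (use WhileTrue in blast)+
qed


section \<open>Input of a program\<close>

definition arec_input ::
    "nat \<Rightarrow> nat \<Rightarrow> nat \<Rightarrow> (nat \<Rightarrow> nat) \<Rightarrow> (nat \<Rightarrow> real) \<Rightarrow> (nat \<Rightarrow> real) \<Rightarrow> real \<Rightarrow> state" where
  "arec_input n p k x clo chi \<Gamma> =
     \<lparr>nmem = (\<lambda>_ _. 0)
        (''n'' := (\<lambda>_. 0)(0 := n),
         ''p'' := (\<lambda>_. 0)(0 := p),
         ''k'' := (\<lambda>_. 0)(0 := k),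
         ''x'' := (\<lambda>i. if i \<in> {1..n} then x i else 0)),
      rmem = (\<lambda>_ _. 0)
        (''clo'' := (\<lambda>i. if i \<in> {1..n} then clo i else 0),
         ''chi'' := (\<lambda>i. if i \<in> {1..n} then chi i else 0),
         ''Gamma'' := (\<lambda>_. 0)(0 := \<Gamma>))\<rparr>"

text \<open>A program solves AREC in time \<open>T\<close> if on every valid instance it halts within \<open>T n\<close>
  time units, leaving the worst-case scenario in the array \<open>c\<close> and its value in \<open>v\<close>.\<close>

definition solves_arec_in_time :: "com \<Rightarrow> (nat \<Rightarrow> nat) \<Rightarrow> bool" where
  "solves_arec_in_time prog T \<longleftrightarrow>
     (\<forall>n p k x clo chi \<Gamma>. arec_instance n p k x clo chi \<Gamma> \<longrightarrow>
        (\<exists>t s. exec prog (arec_input n p k x clo chi \<Gamma>) t s \<and> t \<le> T n \<and>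
           arec_solution n p k x clo chi \<Gamma> (\<lambda>i\<in>{1..n}. rmem s ''c'' i) (rmem s ''v'' 0)))"

end

theory Submission
  imports Defs
begin

text \<open>
  By linear programming duality the optimal recovery cost in a scenario \<open>c\<close> is the maximum over
  prices \<open>a \<ge> b\<close> of \<open>(p - k) a + k b - \<Sum>(level\<^sub>i - c\<^sub>i)\<^sup>+\<close>, where \<open>level\<^sub>i\<close> is \<open>a\<close> for the items of
  \<open>x\<close> and \<open>b\<close> for the others. For fixed prices the best scenario is explicit, so the adversary has to
  maximise a function \<open>min (P a b) (Q a b)\<close> of two reals, where \<open>P\<close> and \<open>Q\<close> are concave, separable
  and affine on the cells of the grid spanned by the \<open>2 n\<close> interval bounds. Triangulating the cells,
  a maximum is found at a grid point or where \<open>P = Q\<close> on one of the \<open>O(n\<^sup>2)\<close> edges. With the summands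
  of \<open>P\<close> and \<open>Q\<close> tabulated at the breakpoints, each edge takes constant time. Concavity makes
  every candidate a lower bound on the optimum, and the scenario is read off from the best prices.
\<close>

text \<open>Once dualised, the inner problem is a maximisation too, so it commutes with the maximum
  over scenarios, and for fixed prices the latter is a closed formula. On a triangle, maximising
  \<open>min P Q\<close> is the linear program of maximising t subject to t \<le> P and t \<le> Q. A
  vertex of this three-dimensional program has three tight constraints, at most two of which bound
  t, so it lies on an edge of the triangle. P and Q are affine on whole cells: the diagonals are
  there for the cells that the line a = b cuts, and cutting every cell keeps the treatment uniform.
  Strong duality with a equal to some cost and b nonnegative keeps the grid bounded. No sorting
  takes place: a linear scan per breakpoint for its successor fits the quadratic budget, and
  repeated breakpoints merely repeat some edges.\<close>

section \<open>The minimum of two affine functions on a triangle\<close>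

text \<open>The parameter \<open>r\<close> at which \<open>P + r (P' - P)\<close> and \<open>Q + r (Q' - Q)\<close> agree. For a
  degenerate segment the division by zero gives \<open>r = 0\<close>, that is, the start of the segment; this is
  how the search below visits the grid points themselves.\<close>

definition crossing :: "real \<Rightarrow> real \<Rightarrow> real \<Rightarrow> real \<Rightarrow> real" where
  "crossing P Q P' Q' = (P - Q) / ((P - Q) - (P' - Q'))"

text \<open>A crossing outside the segment imposes nothing: then \<open>P - Q\<close> has one strict
  sign on the segment and the smaller function attains its maximum at an end, which a degenerate
  segment covers.\<close>

definition crossing_le :: "real \<Rightarrow> real \<Rightarrow> real \<Rightarrow> real \<Rightarrow> real \<Rightarrow> bool" where
  "crossing_le M P Q P' Q' \<longleftrightarrow> (let r = crossing P Q P' Q' in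
     0 \<le> r \<and> r \<le> 1 \<longrightarrow> min (P + r * (P' - P)) (Q + r * (Q' - Q)) \<le> M)"

lemma crossing_le_mono: "crossing_le M P Q P' Q' \<Longrightarrow> M \<le> M' \<Longrightarrow> crossing_le M' P Q P' Q'"
  by (auto simp: crossing_le_def Let_def)

lemma crossing_le_self: "crossing_le M P Q P Q \<Longrightarrow> min P Q \<le> M"
  by (simp add: crossing_le_def crossing_def)

text \<open>After subtracting \<open>M\<close> the two ends lie in opposite quadrants, so the
  segment meets the diagonal. The crossing value is nonpositive exactly when the determinant of the
  two ends is: multiplying by the positive denominator clears the division.\<close>

lemma crossing_le_product:
  assumes "crossing_le M P Q P' Q'" "M < P" "Q \<le> M" "P' \<le> M" "M < Q'"
  shows "(P - M) * (Q' - M) \<le> (Q - M) * (P' - M)"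
proof -
  let ?D = "(P - Q) - (P' - Q')" and ?r = "crossing P Q P' Q'"
  have D: "?D > 0" and r: "0 \<le> ?r" "?r \<le> 1"
    using assms by (auto simp: crossing_def field_simps)
  have rD: "?r * ?D = P - Q" using D by (simp add: crossing_def)
  have "P + ?r * (P' - P) = Q + ?r * (Q' - Q)" using rD by (simp add: algebra_simps)
  with assms(1) r have "P + ?r * (P' - P) \<le> M" by (simp add: crossing_le_def Let_def)
  then have "(P - M + ?r * (P' - P)) * ?D \<le> 0" using D by (intro mult_nonpos_nonneg) auto
  moreover have "(P - M + ?r * (P' - P)) * ?D = (P - M) * ?D + (?r * ?D) * (P' - P)"
    by (simp add: algebra_simps)
  ultimately show ?thesis unfolding rD by (simp add: algebra_simps)
qed

lemma crossing_le_swap: "crossing_le M Q P Q' P' \<longleftrightarrow> crossing_le M P Q P' Q'"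
proof -
  have "crossing Q P Q' P' = crossing P Q P' Q'"
    unfolding crossing_def by (smt (verit, best) minus_divide_divide)
  then show ?thesis by (simp add: crossing_le_def Let_def min.commute)
qed

text \<open>Let u be the weighted sum of the first two vectors and v the weighted third. By
  bilinearity the determinant of u and v is nonpositive; if both coordinates of u + v were positive,
  the sign conditions would make it positive.\<close>

lemma cross_sum_le:
  fixes p0 q0 p1 q1 p2 q2 w0 w1 w2 :: real
  assumes "w0 \<ge> 0" "w1 \<ge> 0" "w2 \<ge> 0"
    and "p0 * q2 \<le> q0 * p2" "p1 * q2 \<le> q1 * p2"
    and "q0 \<le> 0" "q1 \<le> 0" "p2 \<le> 0"
  shows "min (w0 * p0 + w1 * p1 + w2 * p2) (w0 * q0 + w1 * q1 + w2 * q2) \<le> 0"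
proof (rule ccontr)
  assume "\<not> ?thesis"
  then have 1: "w0 * p0 + w1 * p1 > - (w2 * p2)" and 2: "w2 * q2 > - (w0 * q0 + w1 * q1)" by auto
  have "- (w2 * p2) * - (w0 * q0 + w1 * q1) < (w0 * p0 + w1 * p1) * (w2 * q2)"
  proof (rule mult_strict_mono'[OF 1 2])
    show "0 \<le> - (w2 * p2)" "0 \<le> - (w0 * q0 + w1 * q1)"
      using assms mult_nonneg_nonpos[of w0 q0] mult_nonneg_nonpos[of w1 q1]
        mult_nonneg_nonpos[of w2 p2] by linarith+
  qed
  moreover have "(w2 * w0) * (p0 * q2) \<le> (w2 * w0) * (q0 * p2)"
    "(w2 * w1) * (p1 * q2) \<le> (w2 * w1) * (q1 * p2)"
    using assms by (auto intro!: mult_left_mono)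
  ultimately show False by (simp add: algebra_simps)
qed

definition segment_le :: "real \<Rightarrow> real \<Rightarrow> real \<Rightarrow> real \<Rightarrow> real \<Rightarrow> bool" where
  "segment_le M P Q P' Q' \<longleftrightarrow> min P Q \<le> M \<and> min P' Q' \<le> M \<and> crossing_le M P Q P' Q'"

lemma segment_le_swap: "segment_le M Q P Q' P' \<longleftrightarrow> segment_le M P Q P' Q'"
  by (simp add: segment_le_def crossing_le_swap min.commute)

text \<open>Extends \<open>crossing_le_product\<close> to \<open>P \<le> M\<close>, where the signs
  alone decide, and to either orientation of the segment.\<close>

lemma segment_le_cross:
  assumes "segment_le M P Q P' Q' \<or> segment_le M P' Q' P Q" "Q \<le> M" "P' \<le> M" "M < Q'"
  shows "(P - M) * (Q' - M) \<le> (Q - M) * (P' - M)"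
proof (cases "M < P")
  case True
  then show ?thesis
    \<comment> \<open>The reversed orientation gives the same product inequality once the two
      functions are exchanged.\<close>
    using assms crossing_le_product[of M P Q P' Q'] crossing_le_product[of M Q' P' Q P]
    by (auto simp: segment_le_def crossing_le_swap mult.commute)
next
  case False
  then have "(P - M) * (Q' - M) \<le> 0" "0 \<le> (Q - M) * (P' - M)"
    using assms by (auto simp: mult_le_0_iff zero_le_mult_iff)
  then show ?thesis by linarith
qed

text \<open>Once \<open>M\<close> is subtracted, a point of the open positive quadrant that is a conic combination of
  three vectors, none of them in that quadrant, is already a conic combination of two of them.\<close>

lemma triangle_le:
  assumes 01: "segment_le M p0 q0 p1 q1" and 02: "segment_le M p0 q0 p2 q2"
    and 12: "segment_le M p1 q1 p2 q2"
    and w: "w0 \<ge> 0" "w1 \<ge> 0" "w2 \<ge> 0" "w0 + w1 + w2 = 1"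
  shows "min (w0 * p0 + w1 * p1 + w2 * p2) (w0 * q0 + w1 * q1 + w2 * q2) \<le> M"
proof -
  define a0 b0 a1 b1 a2 b2 where ab: "a0 = p0 - M" "b0 = q0 - M" "a1 = p1 - M" "b1 = q1 - M"
    "a2 = p2 - M" "b2 = q2 - M"
  have "min (w0 * a0 + w1 * a1 + w2 * a2) (w0 * b0 + w1 * b1 + w2 * b2) \<le> 0"
  proof -
    have sign: "a0 \<le> 0 \<or> b0 \<le> 0" "a1 \<le> 0 \<or> b1 \<le> 0" "a2 \<le> 0 \<or> b2 \<le> 0"
      using 01 02 12 by (auto simp: segment_le_def ab)
    \<comment> \<open>If one coordinate is nonpositive at all vertices, so is its weighted sum.
      Otherwise some vertex is positive in a coordinate in which the other two are nonpositive; it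
      becomes the third vector of \<open>cross_sum_le\<close>. Cases 3 to 8 differ only in the
      choice of that vertex and coordinate.\<close>
    consider "b0 \<le> 0" "b1 \<le> 0" "b2 \<le> 0" | "a0 \<le> 0" "a1 \<le> 0" "a2 \<le> 0"
      | "b0 \<le> 0" "b1 \<le> 0" "0 < b2" | "b0 \<le> 0" "0 < b1" "b2 \<le> 0" | "0 < b0" "b1 \<le> 0" "b2 \<le> 0"
      | "a0 \<le> 0" "a1 \<le> 0" "0 < a2" | "a0 \<le> 0" "0 < a1" "a2 \<le> 0" | "0 < a0" "a1 \<le> 0" "a2 \<le> 0"
      using sign by linarith
    then show ?thesis
    proof cases
      case 1
      then have "w0 * b0 + w1 * b1 + w2 * b2 \<le> 0"
        using w by (intro add_nonpos_nonpos mult_nonneg_nonpos) auto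
      then show ?thesis by simp
    next
      case 2
      then have "w0 * a0 + w1 * a1 + w2 * a2 \<le> 0"
        using w by (intro add_nonpos_nonpos mult_nonneg_nonpos) auto
      then show ?thesis by simp
    next
      case 3
      have "a0 * b2 \<le> b0 * a2" "a1 * b2 \<le> b1 * a2"
        using segment_le_cross[of M p0 q0 p2 q2] segment_le_cross[of M p1 q1 p2 q2] 3 sign 01 02 12
        by (auto simp: ab)
      then show ?thesis using cross_sum_le[of w0 w1 w2 a0 b2 b0 a2 a1 b1] w 3 sign
        by (simp add: add_ac min.commute)
    next
      case 4
      have "a0 * b1 \<le> b0 * a1" "a2 * b1 \<le> b2 * a1"
        using segment_le_cross[of M p0 q0 p1 q1] segment_le_cross[of M p2 q2 p1 q1] 4 sign 01 02 12
        by (auto simp: ab)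
      then show ?thesis using cross_sum_le[of w0 w2 w1 a0 b1 b0 a1 a2 b2] w 4 sign
        by (simp add: add_ac min.commute)
    next
      case 5
      have "a1 * b0 \<le> b1 * a0" "a2 * b0 \<le> b2 * a0"
        using segment_le_cross[of M p1 q1 p0 q0] segment_le_cross[of M p2 q2 p0 q0] 5 sign 01 02 12
        by (auto simp: ab)
      then show ?thesis using cross_sum_le[of w1 w2 w0 a1 b0 b1 a0 a2 b2] w 5 sign
        by (simp add: add_ac min.commute)
    next
      case 6
      have "b0 * a2 \<le> a0 * b2" "b1 * a2 \<le> a1 * b2"
        using segment_le_cross[of M q0 p0 q2 p2] segment_le_cross[of M q1 p1 q2 p2] 6 sign 01 02 12
        by (auto simp: ab segment_le_swap)
      then show ?thesis using cross_sum_le[of w0 w1 w2 b0 a2 a0 b2 b1 a1] w 6 sign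
        by (simp add: add_ac min.commute)
    next
      case 7
      have "b0 * a1 \<le> a0 * b1" "b2 * a1 \<le> a2 * b1"
        using segment_le_cross[of M q0 p0 q1 p1] segment_le_cross[of M q2 p2 q1 p1] 7 sign 01 02 12
        by (auto simp: ab segment_le_swap)
      then show ?thesis using cross_sum_le[of w0 w2 w1 b0 a1 a0 b1 b2 a2] w 7 sign
        by (simp add: add_ac min.commute)
    next
      case 8
      have "b1 * a0 \<le> a1 * b0" "b2 * a0 \<le> a2 * b0"
        using segment_le_cross[of M q1 p1 q0 p0] segment_le_cross[of M q2 p2 q0 p0] 8 sign 01 02 12
        by (auto simp: ab segment_le_swap)
      then show ?thesis using cross_sum_le[of w1 w2 w0 b1 a0 a1 b0 b2 a2] w 8 sign
        by (simp add: add_ac min.commute)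
    qed
  qed
  moreover have "w0 * a0 + w1 * a1 + w2 * a2 = w0 * p0 + w1 * p1 + w2 * p2 - (w0 + w1 + w2) * M"
    "w0 * b0 + w1 * b1 + w2 * b2 = w0 * q0 + w1 * q1 + w2 * q2 - (w0 + w1 + w2) * M"
    by (simp_all add: ab algebra_simps)
  ultimately show ?thesis using w by (auto simp: min_le_iff_disj)
qed

section \<open>Duality\<close>

text \<open>The length \<open>m\<close> is a parameter so that prefixes of the sum can serve as
  invariant of the loop that fills the tables.\<close>

definition excess :: "(nat \<Rightarrow> bool) \<Rightarrow> nat \<Rightarrow> (nat \<Rightarrow> real) \<Rightarrow> real \<Rightarrow> real" where
  "excess S m c a = (\<Sum>i=1..m. if S i then max 0 (a - c i) else 0)"

locale arec =
  fixes n p k :: nat and x :: "nat \<Rightarrow> nat" and clo chi :: "nat \<Rightarrow> real" and \<Gamma> :: real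
  assumes arec: "arec_instance n p k x clo chi \<Gamma>"
begin

lemma p_pos: "0 < p" and k_le_p: "k \<le> p" and \<Gamma>_nonneg: "0 \<le> \<Gamma>" and x_Phi: "x \<in> Phi n p"
  using arec by (auto simp: arec_instance_def)

lemma costs: "i \<in> {1..n} \<Longrightarrow> 0 \<le> clo i" "i \<in> {1..n} \<Longrightarrow> clo i \<le> chi i"
  using arec by (auto simp: arec_instance_def)

lemma x_cases: "i \<in> {1..n} \<Longrightarrow> x i = 0 \<or> x i = 1"
  using PiE_mem[of x "{1..n}" "\<lambda>_. {0, 1}" i] x_Phi by (simp add: Phi_def)

definition old_part :: "(nat \<Rightarrow> real) \<Rightarrow> real \<Rightarrow> real" where
  "old_part c a = real (p - k) * a - excess (\<lambda>i. x i = 1) n c a"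

definition new_part :: "(nat \<Rightarrow> real) \<Rightarrow> real \<Rightarrow> real" where
  "new_part c b = real k * b - excess (\<lambda>i. x i \<noteq> 1) n c b"

text \<open>Linear programming dual of the selection of \<open>y\<close>: \<open>b\<close> prices the constraint on \<open>\<Sum>y\<close>, and
  \<open>a - b \<ge> 0\<close> the constraint on \<open>\<Sum>x y\<close>.\<close>

definition dual :: "(nat \<Rightarrow> real) \<Rightarrow> real \<Rightarrow> real \<Rightarrow> real" where
  "dual c a b = old_part c a + new_part c b"

definition level :: "real \<Rightarrow> real \<Rightarrow> nat \<Rightarrow> real" where
  "level a b i = (if x i = 1 then a else b)"

text \<open>The largest value of \<open>dual c a b\<close> over all scenarios \<open>c\<close>: a raised cost is useful only up to the
  level \<open>a\<close> or \<open>b\<close> of its item, and the total raise is limited by the budget or by the intervals.\<close>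

definition bound :: "real \<Rightarrow> real \<Rightarrow> real" where
  "bound a b = min (dual clo a b + \<Gamma>) (dual chi a b)"

text \<open>The definition by parts is what the tables store; this form treats all items alike, as
  the duality and budget arguments need.\<close>

lemma dual_eq:
  "dual c a b = real (p - k) * a + real k * b - (\<Sum>i=1..n. max 0 (level a b i - c i))"
proof -
  have "(\<Sum>i=1..n. max 0 (level a b i - c i)) =
    (\<Sum>i=1..n. (if x i = 1 then max 0 (a - c i) else 0) + (if x i \<noteq> 1 then max 0 (b - c i) else 0))"
    by (intro sum.cong) (auto simp: level_def)
  then show ?thesis by (simp add: dual_def old_part_def new_part_def excess_def sum.distrib)
qed

text \<open>Since \<open>x\<close> is 0/1 on the items, \<open>level a b i\<close> equals
  \<open>b + (a - b) * x i\<close> there.\<close>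

lemma sum_level:
  "(\<Sum>i=1..n. level a b i * real (y i)) =
    (a - b) * real (\<Sum>i=1..n. x i * y i) + b * real (\<Sum>i=1..n. y i)"
proof -
  have "(\<Sum>i=1..n. level a b i * real (y i)) = (\<Sum>i=1..n. (a - b) * real (x i * y i) + b * real (y i))"
  proof (rule sum.cong)
    fix i assume "i \<in> {1..n}"
    from x_cases[OF this]
    show "level a b i * real (y i) = (a - b) * real (x i * y i) + b * real (y i)"
      by (auto simp: level_def algebra_simps)
  qed simp
  also have "\<dots> = (a - b) * real (\<Sum>i=1..n. x i * y i) + b * real (\<Sum>i=1..n. y i)"
    by (simp only: sum.distrib sum_distrib_left of_nat_sum)
  finally show ?thesis .
qed

lemma Phi_rec_cases:
  assumes "y \<in> Phi_rec n p k x" "i \<in> {1..n}"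
  shows "y i = 0 \<or> y i = 1"
  using PiE_mem[of y "{1..n}" "\<lambda>_. {0, 1}" i] assms by (simp add: Phi_rec_def)

lemma weak_duality:
  assumes "b \<le> a" "y \<in> Phi_rec n p k x"
  shows "dual c a b \<le> (\<Sum>i=1..n. c i * real (y i))"
proof -
  note y = Phi_rec_cases[OF assms(2)]
  define m where "m = (\<Sum>i=1..n. x i * y i)"
  have sy: "(\<Sum>i=1..n. y i) = p" and m: "p - k \<le> m"
    using assms(2) by (auto simp: Phi_rec_def m_def)
  have "(\<Sum>i=1..n. level a b i * real (y i)) = (a - b) * real m + b * real p"
    by (simp only: sum_level m_def sy)
  also have "\<dots> \<ge> (a - b) * real (p - k) + b * real p"
    using assms(1) m by (simp add: mult_left_mono)
  finally have "real (p - k) * a + real k * b \<le> (\<Sum>i=1..n. level a b i * real (y i))"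
    using k_le_p by (simp add: of_nat_diff algebra_simps)
  moreover have "(\<Sum>i=1..n. level a b i * real (y i)) - (\<Sum>i=1..n. max 0 (level a b i - c i)) \<le>
      (\<Sum>i=1..n. c i * real (y i))"
    unfolding sum_subtractf[symmetric]
  proof (rule sum_mono)
    fix i assume "i \<in> {1..n}"
    from y[OF this] show "level a b i * real (y i) - max 0 (level a b i - c i) \<le> c i * real (y i)"
      by auto
  qed
  ultimately show ?thesis by (simp add: dual_eq)
qed

text \<open>Removing \<open>i\<close> lowers the overlap with \<open>x\<close> by at most one, which
  either \<open>j\<close> or a strict surplus makes up for.\<close>

lemma Phi_rec_swap:
  assumes y: "y \<in> Phi_rec n p k x" and i: "i \<in> {1..n}" "y i = 1" and j: "j \<in> {1..n}" "y j = 0"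
    and ok: "x i \<le> x j \<or> p - k < (\<Sum>i=1..n. x i * y i)"
  shows "y(i := 0, j := 1) \<in> Phi_rec n p k x"
    and "(\<Sum>l=1..n. c l * real ((y(i := 0, j := 1)) l)) = (\<Sum>l=1..n. c l * real (y l)) - c i + c j"
proof -
  let ?y = "y(i := 0, j := 1)"
  have ij: "i \<noteq> j" using i j by auto
  \<comment> \<open>Stated for arbitrary weights: 1 gives the cardinality, \<open>x\<close> the
    overlap and \<open>c\<close> the cost.\<close>
  have upd: "(\<Sum>l=1..n. g l * real (?y l)) = (\<Sum>l=1..n. g l * real (y l)) - g i + g j" for g :: "nat \<Rightarrow> real"
  proof -
    have split: "sum h {1..n} = sum h ({1..n} - {i} - {j}) + h i + h j" for h :: "nat \<Rightarrow> real"
      using i(1) j(1) ij sum.remove[of "{1..n}" i h] sum.remove[of "{1..n} - {i}" j h] by simp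
    have "(\<Sum>l=1..n. g l * real (?y l)) = (\<Sum>l\<in>{1..n} - {i} - {j}. g l * real (?y l)) + g j"
      using ij split[of "\<lambda>l. g l * real (?y l)"] by simp
    also have "(\<Sum>l\<in>{1..n} - {i} - {j}. g l * real (?y l)) = (\<Sum>l\<in>{1..n} - {i} - {j}. g l * real (y l))"
      by (intro sum.cong) auto
    also have "\<dots> = (\<Sum>l=1..n. g l * real (y l)) - g i"
      using i(2) j(2) split[of "\<lambda>l. g l * real (y l)"] by simp
    finally show ?thesis .
  qed
  show "(\<Sum>l=1..n. c l * real (?y l)) = (\<Sum>l=1..n. c l * real (y l)) - c i + c j"
    by (rule upd)
  have "real (\<Sum>l=1..n. ?y l) = real (\<Sum>l=1..n. y l)"
    using upd[of "\<lambda>_. 1"] by (simp del: fun_upd_apply)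
  then have 1: "(\<Sum>l=1..n. ?y l) = (\<Sum>l=1..n. y l)"
    using of_nat_eq_iff by blast
  have "real (\<Sum>l=1..n. x l * ?y l) = real ((\<Sum>l=1..n. x l * y l)) - real (x i) + real (x j)"
    using upd[of "\<lambda>l. real (x l)"] by (simp del: fun_upd_apply)
  then have "(\<Sum>l=1..n. x l * ?y l) + x i = (\<Sum>l=1..n. x l * y l) + x j"
    by linarith
  then have 2: "(\<Sum>l=1..n. x l * ?y l) \<ge> p - k"
    using ok x_cases[OF i(1)] y by (auto simp: Phi_rec_def simp del: fun_upd_apply)
  have "?y \<in> {1..n} \<rightarrow>\<^sub>E {0, 1}"
    using y i j by (auto simp: Phi_rec_def PiE_iff extensional_def)
  with 1 2 y show "?y \<in> Phi_rec n p k x" by (simp add: Phi_rec_def del: fun_upd_apply)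
qed

lemma recovery_cost_le: "y \<in> Phi_rec n p k x \<Longrightarrow> recovery_cost n p k x c \<le> (\<Sum>i=1..n. c i * real (y i))"
  unfolding recovery_cost_def by (intro Min_le finite_imageI finite_Phi_rec) auto

lemma recovery_cost_attained:
  obtains y where "y \<in> Phi_rec n p k x" "recovery_cost n p k x c = (\<Sum>i=1..n. c i * real (y i))"
proof -
  have "recovery_cost n p k x c \<in> (\<lambda>y. \<Sum>i=1..n. c i * real (y i)) ` Phi_rec n p k x"
    unfolding recovery_cost_def
    by (intro Min_in finite_imageI finite_Phi_rec) (use mem_Phi_rec[OF x_Phi] in auto)
  then show thesis using that by auto
qed

text \<open>Exchange optimality of a cheapest \<open>y\<close> yields prices satisfying
  complementary slackness. That \<open>a\<close> is a cost and \<open>b\<close> is nonnegative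
  bounds the region the search has to cover.\<close>

lemma strong_duality:
  assumes c: "\<And>i. i \<in> {1..n} \<Longrightarrow> 0 \<le> c i"
  obtains a b i where "0 \<le> b" "b \<le> a" "i \<in> {1..n}" "a = c i" "recovery_cost n p k x c = dual c a b"
proof -
  obtain y where y: "y \<in> Phi_rec n p k x"
    and cost: "recovery_cost n p k x c = (\<Sum>i=1..n. c i * real (y i))"
    by (rule recovery_cost_attained)
  note y01 = Phi_rec_cases[OF y]
  have sy: "(\<Sum>i=1..n. y i) = p" and ge: "p - k \<le> (\<Sum>i=1..n. x i * y i)"
    using y by (auto simp: Phi_rec_def)
  have exch: "c i \<le> c j"
    if "i \<in> {1..n}" "y i = 1" "j \<in> {1..n}" "y j = 0" "x i \<le> x j \<or> p - k < (\<Sum>i=1..n. x i * y i)" for i j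
    using recovery_cost_le[OF Phi_rec_swap(1)[OF y that], of c]
    unfolding Phi_rec_swap(2)[OF y that] cost by simp
  define A where "A = {i \<in> {1..n}. y i = 1}"
  define B where "B = {i \<in> A. x i = 0}"
  have "A \<noteq> {}"
  proof
    assume "A = {}"
    then have "(\<Sum>i=1..n. y i) = 0" using y01 by (auto simp: A_def)
    with sy p_pos show False by simp
  qed
  have fin: "finite A" "finite B" by (auto simp: A_def B_def)
  define a where "a = Max (c ` A)"
  have "a \<in> c ` A" unfolding a_def using fin \<open>A \<noteq> {}\<close> by (intro Max_in) auto
  then obtain i0 where i0: "i0 \<in> A" "a = c i0" by auto
  have a_ge: "c i \<le> a" if "i \<in> A" for i
    unfolding a_def using fin that by (intro Max_ge) auto
  have "0 \<le> a" using i0 c by (auto simp: A_def)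
  \<comment> \<open>The multiplier \<open>a - b\<close> has to vanish when the overlap exceeds its
    lower bound. Otherwise \<open>b\<close> is the largest cost of a selected item outside
    \<open>x\<close>; the inserted 0 covers the case that there is no such item.\<close>
  define b where "b = (if p - k < (\<Sum>i=1..n. x i * y i) then a else Max (insert 0 (c ` B)))"
  have b_cases: "b = 0 \<or> b \<in> c ` B" if "\<not> p - k < (\<Sum>i=1..n. x i * y i)"
    using Max_in[of "insert 0 (c ` B)"] fin that by (auto simp: b_def)
  have b_ge: "c i \<le> b" if "i \<in> B" for i
    unfolding b_def using fin that a_ge by (auto simp: B_def intro!: Max_ge)
  have "0 \<le> b" using \<open>0 \<le> a\<close> fin by (auto simp: b_def)
  have "b \<le> a" using fin a_ge \<open>0 \<le> a\<close> by (auto simp: b_def B_def)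
  have i0': "i0 \<in> {1..n}" "y i0 = 1" using i0 by (auto simp: A_def)
  \<comment> \<open>Complementary slackness: selected items cost at most their level, unselected
    ones at least. The latter is where optimality enters, through \<open>exch\<close>.\<close>
  have slack: "max 0 (level a b i - c i) = (level a b i - c i) * real (y i)" if i: "i \<in> {1..n}" for i
  proof (cases "y i = 1")
    case True
    then have "c i \<le> level a b i"
      using i x_cases[OF i] a_ge b_ge by (auto simp: level_def A_def B_def)
    with True show ?thesis by simp
  next
    case False
    then have y0: "y i = 0" using y01 i by auto
    have "level a b i \<le> c i"
    proof (cases "x i = 1 \<or> p - k < (\<Sum>i=1..n. x i * y i)")
      case True
      then have "a \<le> c i" using exch[OF i0' i y0] i0 x_cases[OF i0'(1)] by auto
      then show ?thesis using \<open>b \<le> a\<close> by (auto simp: level_def)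
    next
      case F: False
      then consider "b = 0" | j where "j \<in> B" "b = c j" using b_cases by auto
      then show ?thesis
      proof cases
        case 1 then show ?thesis using F c[OF i] by (auto simp: level_def)
      next
        case 2 then show ?thesis using F exch[of j i] i y0 by (auto simp: level_def A_def B_def)
      qed
    qed
    with y0 show ?thesis by simp
  qed
  define m where "m = (\<Sum>i=1..n. x i * y i)"
  have "(\<Sum>i=1..n. level a b i * real (y i)) = (a - b) * real m + b * real p"
    by (simp only: sum_level m_def sy)
  also have "\<dots> = real (p - k) * a + real k * b"
  proof (cases "p - k < m")
    case True
    then show ?thesis using k_le_p by (simp add: b_def m_def of_nat_diff algebra_simps)
  next
    case False
    then have "m = p - k" using ge by (simp add: m_def)
    then show ?thesis using k_le_p by (simp add: of_nat_diff algebra_simps)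
  qed
  finally have *: "(\<Sum>i=1..n. level a b i * real (y i)) = real (p - k) * a + real k * b" .
  have "(\<Sum>i=1..n. max 0 (level a b i - c i)) = (\<Sum>i=1..n. (level a b i - c i) * real (y i))"
    using slack by (intro sum.cong) auto
  also have "\<dots> = (\<Sum>i=1..n. level a b i * real (y i)) - (\<Sum>i=1..n. c i * real (y i))"
    by (simp add: sum_subtractf left_diff_distrib)
  finally have "dual c a b = recovery_cost n p k x c"
    using * by (simp add: dual_eq cost)
  then show thesis using that[of b a i0] \<open>0 \<le> b\<close> \<open>b \<le> a\<close> i0' i0 by auto
qed

section \<open>The best scenario for fixed prices\<close>

lemma dual_le_bound:
  assumes "c \<in> scenarios n clo chi \<Gamma>"
  shows "dual c a b \<le> bound a b"
proof -
  obtain \<delta> where c: "c = (\<lambda>i\<in>{1..n}. clo i + \<delta> i)"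
    and \<delta>: "\<And>i. i \<in> {1..n} \<Longrightarrow> 0 \<le> \<delta> i \<and> \<delta> i \<le> chi i - clo i" and sum: "(\<Sum>i=1..n. \<delta> i) \<le> \<Gamma>"
    using assms by (auto simp: scenarios_def)
  \<comment> \<open>Each hinge drops by at most the raise of its cost, so in total by at most
    \<open>\<Gamma>\<close>. It is also antitone in the cost, which is at most
    \<open>chi i\<close>.\<close>
  have "(\<Sum>i=1..n. max 0 (level a b i - clo i)) \<le> (\<Sum>i=1..n. max 0 (level a b i - c i) + \<delta> i)"
    by (intro sum_mono) (use \<delta> c in fastforce)
  moreover have "(\<Sum>i=1..n. max 0 (level a b i - chi i)) \<le> (\<Sum>i=1..n. max 0 (level a b i - c i))"
    by (intro sum_mono) (use \<delta> c in fastforce)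
  ultimately show ?thesis using sum by (simp add: bound_def dual_eq sum.distrib)
qed

definition raise :: "real \<Rightarrow> real \<Rightarrow> nat \<Rightarrow> real" where
  "raise a b i = min (chi i - clo i) (max 0 (level a b i - clo i))"

text \<open>Up to the levels every unit of raise gains one unit of \<open>dual\<close>, so all ways
  of spending the budget are equally good; the proportional one needs only the total. In the first
  branch \<open>W\<close> is positive because \<open>\<Gamma>\<close> is nonnegative.\<close>

definition scale :: "real \<Rightarrow> real \<Rightarrow> real" where
  "scale a b = (let W = \<Sum>i=1..n. raise a b i in if \<Gamma> < W then \<Gamma> / W else 1)"

definition worst_scenario :: "real \<Rightarrow> real \<Rightarrow> nat \<Rightarrow> real" where
  "worst_scenario a b = (\<lambda>i\<in>{1..n}. clo i + scale a b * raise a b i)"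

lemma scale_bounds: "0 \<le> scale a b" "scale a b \<le> 1"
  using \<Gamma>_nonneg by (auto simp: scale_def Let_def)

lemma scale_budget: "scale a b * (\<Sum>i=1..n. raise a b i) = min \<Gamma> (\<Sum>i=1..n. raise a b i)"
  using \<Gamma>_nonneg by (auto simp: scale_def Let_def)

lemma raise_bounds:
  assumes "i \<in> {1..n}"
  shows "0 \<le> scale a b * raise a b i" "scale a b * raise a b i \<le> raise a b i"
    "raise a b i \<le> chi i - clo i" "raise a b i \<le> max 0 (level a b i - clo i)"
proof -
  have "0 \<le> raise a b i" using costs[OF assms] by (auto simp: raise_def)
  then show "0 \<le> scale a b * raise a b i" "scale a b * raise a b i \<le> raise a b i"
    using scale_bounds[of a b] by (auto intro: mult_left_le_one_le)
qed (auto simp: raise_def)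

lemma worst_scenario_mem: "worst_scenario a b \<in> scenarios n clo chi \<Gamma>"
proof -
  have "(\<Sum>i=1..n. scale a b * raise a b i) \<le> \<Gamma>"
    using scale_budget[of a b] by (simp add: sum_distrib_left[symmetric])
  moreover have "scale a b * raise a b i \<in> {0..chi i - clo i}" if "i \<in> {1..n}" for i
    using raise_bounds[OF that, of a b] by auto
  ultimately show ?thesis
    by (auto simp: scenarios_def worst_scenario_def intro!: exI[of _ "\<lambda>i. scale a b * raise a b i"])
qed

text \<open>Scaled raises never pass the level, so the hinges drop exactly by the raises,
  \<open>min \<Gamma> W\<close> in total. Full raises turn the hinges at \<open>clo\<close> into
  those at \<open>chi\<close>, which gives the second argument of \<open>bound\<close>.\<close>

lemma dual_worst_scenario: "dual (worst_scenario a b) a b = bound a b"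
proof -
  let ?L = "\<Sum>i=1..n. max 0 (level a b i - clo i)" and ?W = "\<Sum>i=1..n. raise a b i"
  have "(\<Sum>i=1..n. max 0 (level a b i - worst_scenario a b i)) =
      (\<Sum>i=1..n. max 0 (level a b i - clo i) - scale a b * raise a b i)"
  proof (rule sum.cong)
    fix i assume i: "i \<in> {1..n}"
    show "max 0 (level a b i - worst_scenario a b i) =
        max 0 (level a b i - clo i) - scale a b * raise a b i"
      using raise_bounds[OF i, of a b] i by (auto simp: worst_scenario_def max_def split: if_splits)
  qed simp
  also have "\<dots> = ?L - min \<Gamma> ?W"
    using scale_budget[of a b] by (simp add: sum_subtractf sum_distrib_left[symmetric])
  finally have 1: "(\<Sum>i=1..n. max 0 (level a b i - worst_scenario a b i)) = ?L - min \<Gamma> ?W" .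
  have "(\<Sum>i=1..n. max 0 (level a b i - chi i)) = (\<Sum>i=1..n. max 0 (level a b i - clo i) - raise a b i)"
    by (intro sum.cong) (use costs in \<open>fastforce simp: raise_def\<close>)+
  then have "(\<Sum>i=1..n. max 0 (level a b i - chi i)) = ?L - ?W" by (simp add: sum_subtractf)
  with 1 show ?thesis by (simp add: bound_def dual_eq)
qed

lemma bound_le_recovery_cost:
  assumes "b \<le> a"
  shows "bound a b \<le> recovery_cost n p k x (worst_scenario a b)"
  by (metis assms dual_worst_scenario recovery_cost_attained weak_duality)

text \<open>A sandwich: \<open>v\<close> is at most \<open>bound a b\<close>, hence at most the
  recovery cost of the worst scenario, which in turn is at most \<open>v\<close>. The last
  assumption ranges only over prices that strong duality can produce.\<close>

lemma arec_solution_if_bound_maximal: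
  assumes "b \<le> a" "v \<le> bound a b"
    and max: "\<And>a' b' i. 0 \<le> b' \<Longrightarrow> b' \<le> a' \<Longrightarrow> i \<in> {1..n} \<Longrightarrow> a' \<le> chi i \<Longrightarrow> bound a' b' \<le> v"
  shows "arec_solution n p k x clo chi \<Gamma> (worst_scenario a b) v"
proof -
  have upper: "recovery_cost n p k x c \<le> v" if c: "c \<in> scenarios n clo chi \<Gamma>" for c
  proof -
    have ci: "0 \<le> c i \<and> c i \<le> chi i" if "i \<in> {1..n}" for i
      using c that costs[OF that] by (force simp: scenarios_def)
    then obtain a' b' i where *: "0 \<le> b'" "b' \<le> a'" "i \<in> {1..n}" "a' = c i"
      "recovery_cost n p k x c = dual c a' b'"
      using strong_duality[of c] by metis
    then show ?thesis using dual_le_bound[OF c, of a' b'] max[of b' a' i] ci[of i] by auto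
  qed
  have "recovery_cost n p k x (worst_scenario a b) = v"
    using upper[OF worst_scenario_mem] bound_le_recovery_cost[OF assms(1)] assms(2)
    by (meson antisym order_trans)
  then show ?thesis
    using upper worst_scenario_mem by (auto simp: arec_solution_def is_arg_max_linorder)
qed

end

section \<open>The grid of breakpoints\<close>

lemma hinge_convex:
  fixes r u v w :: real
  assumes "0 \<le> r" "r \<le> 1"
  shows "max 0 (u + r * (v - u) - w) \<le> max 0 (u - w) + r * (max 0 (v - w) - max 0 (u - w))"
proof -
  have "(1 - r) * (u - w) \<le> (1 - r) * max 0 (u - w)" "r * (v - w) \<le> r * max 0 (v - w)"
    "0 \<le> (1 - r) * max 0 (u - w)" "0 \<le> r * max 0 (v - w)"
    using assms by (auto intro!: mult_left_mono)
  moreover have mix: "A + r * (B - A) = (1 - r) * A + r * B" for A B :: real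
    by (simp add: algebra_simps)
  moreover have "u + r * (v - u) - w = (1 - r) * (u - w) + r * (v - w)"
    unfolding mix by (simp add: algebra_simps)
  ultimately show ?thesis unfolding mix[of "max 0 (u - w)"] by linarith
qed

lemma hinge_linear:
  fixes r u v w :: real
  assumes "0 \<le> r" "r \<le> 1" "u \<le> v" "w \<le> u \<or> v \<le> w"
  shows "max 0 (u + r * (v - u) - w) = max 0 (u - w) + r * (max 0 (v - w) - max 0 (u - w))"
proof -
  have "0 \<le> r * (v - u)" "r * (v - u) \<le> v - u"
    using assms by (auto intro: mult_left_le_one_le)
  then show ?thesis
  proof (cases "w \<le> u")
    case True
    with \<open>0 \<le> r * (v - u)\<close> assms have "max 0 (u + r * (v - u) - w) = u + r * (v - u) - w"
      "max 0 (u - w) = u - w" "max 0 (v - w) = v - w" by linarith+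
    then show ?thesis by simp
  next
    case False
    with \<open>r * (v - u) \<le> v - u\<close> assms have "max 0 (u + r * (v - u) - w) = 0"
      "max 0 (u - w) = 0" "max 0 (v - w) = 0" by linarith+
    then show ?thesis by simp
  qed
qed

text \<open>The quotient fixes \<open>r\<close> even for \<open>u = v\<close>, where division by
  zero gives 0, so two points of one segment can be compared through their coordinates.\<close>

lemma segment_coordinate:
  fixes a u v :: real
  assumes "u \<le> a" "a \<le> v"
  obtains r where "0 \<le> r" "r \<le> 1" "a = u + r * (v - u)" "r = (a - u) / (v - u)"
proof (cases "u = v")
  case True
  with assms show thesis by (intro that[of 0]) auto
next
  case False
  with assms show thesis by (intro that[of "(a - u) / (v - u)"]) (auto simp: divide_le_eq_1)
qed

lemma excess_convex:
  assumes "0 \<le> r" "r \<le> 1"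
  shows "excess S m c (u + r * (v - u)) \<le> excess S m c u + r * (excess S m c v - excess S m c u)"
proof -
  have "excess S m c (u + r * (v - u)) \<le>
      (\<Sum>i=1..m. (if S i then max 0 (u - c i) else 0)
        + r * ((if S i then max 0 (v - c i) else 0) - (if S i then max 0 (u - c i) else 0)))"
    unfolding excess_def using hinge_convex[OF assms] by (intro sum_mono) simp
  also have "\<dots> = excess S m c u + r * (excess S m c v - excess S m c u)"
    by (simp add: excess_def sum.distrib sum_subtractf sum_distrib_left[symmetric])
  finally show ?thesis .
qed

lemma excess_linear:
  assumes "0 \<le> r" "r \<le> 1" "u \<le> v" "\<And>i. i \<in> {1..m} \<Longrightarrow> c i \<le> u \<or> v \<le> c i"
  shows "excess S m c (u + r * (v - u)) = excess S m c u + r * (excess S m c v - excess S m c u)"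
proof -
  have "excess S m c (u + r * (v - u)) =
      (\<Sum>i=1..m. (if S i then max 0 (u - c i) else 0)
        + r * ((if S i then max 0 (v - c i) else 0) - (if S i then max 0 (u - c i) else 0)))"
    unfolding excess_def
  proof (rule sum.cong)
    fix i assume "i \<in> {1..m}"
    from hinge_linear[OF assms(1-3) assms(4)[OF this]]
    show "(if S i then max 0 (u + r * (v - u) - c i) else 0) = (if S i then max 0 (u - c i) else 0)
        + r * ((if S i then max 0 (v - c i) else 0) - (if S i then max 0 (u - c i) else 0))" by simp
  qed simp
  also have "\<dots> = excess S m c u + r * (excess S m c v - excess S m c u)"
    by (simp add: excess_def sum.distrib sum_subtractf sum_distrib_left[symmetric])
  finally show ?thesis .
qed

context arec
begin

lemma old_part_concave:
  assumes "0 \<le> r" "r \<le> 1"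
  shows "old_part c u + r * (old_part c v - old_part c u) \<le> old_part c (u + r * (v - u))"
  using excess_convex[OF assms, of "\<lambda>i. x i = 1" n c u v] unfolding old_part_def
  by (simp only: left_diff_distrib right_diff_distrib distrib_left distrib_right mult.left_commute)

lemma new_part_concave:
  assumes "0 \<le> r" "r \<le> 1"
  shows "new_part c u + r * (new_part c v - new_part c u) \<le> new_part c (u + r * (v - u))"
  using excess_convex[OF assms, of "\<lambda>i. x i \<noteq> 1" n c u v] unfolding new_part_def
  by (simp only: left_diff_distrib right_diff_distrib distrib_left distrib_right mult.left_commute)

lemma old_part_linear:
  assumes "0 \<le> r" "r \<le> 1" "u \<le> v" "\<And>i. i \<in> {1..n} \<Longrightarrow> c i \<le> u \<or> v \<le> c i"
  shows "old_part c (u + r * (v - u)) = old_part c u + r * (old_part c v - old_part c u)"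
  using excess_linear[of r u v n c "\<lambda>i. x i = 1", OF assms] unfolding old_part_def
  by (simp only: left_diff_distrib right_diff_distrib distrib_left distrib_right mult.left_commute)

lemma new_part_linear:
  assumes "0 \<le> r" "r \<le> 1" "u \<le> v" "\<And>i. i \<in> {1..n} \<Longrightarrow> c i \<le> u \<or> v \<le> c i"
  shows "new_part c (u + r * (v - u)) = new_part c u + r * (new_part c v - new_part c u)"
  using excess_linear[of r u v n c "\<lambda>i. x i \<noteq> 1", OF assms] unfolding new_part_def
  by (simp only: left_diff_distrib right_diff_distrib distrib_left distrib_right mult.left_commute)

lemma dual_concave:
  assumes "0 \<le> r" "r \<le> 1"
  shows "dual c a b + r * (dual c a' b' - dual c a b) \<le> dual c (a + r * (a' - a)) (b + r * (b' - b))"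
  using old_part_concave[OF assms, of c a a'] new_part_concave[OF assms, of c b b']
  by (simp add: dual_def algebra_simps)

abbreviation bound_lo :: "real \<Rightarrow> real \<Rightarrow> real" where
  "bound_lo a b \<equiv> dual clo a b + \<Gamma>"

abbreviation bound_hi :: "real \<Rightarrow> real \<Rightarrow> real" where
  "bound_hi a b \<equiv> dual chi a b"

lemma bound_segment:
  assumes "0 \<le> r" "r \<le> 1"
  shows "min (bound_lo a b + r * (bound_lo a' b' - bound_lo a b))
      (bound_hi a b + r * (bound_hi a' b' - bound_hi a b)) \<le> bound (a + r * (a' - a)) (b + r * (b' - b))"
  using dual_concave[OF assms, of clo a b a' b'] dual_concave[OF assms, of chi a b a' b']
  by (simp add: bound_def algebra_simps min_le_iff_disj)

text \<open>The index \<open>0\<close> adds the breakpoint \<open>0\<close>, a lower bound on every price given by strong duality.\<close>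

definition node :: "nat \<Rightarrow> real" where
  "node l = (if l = 0 then 0 else if l \<le> n then clo l else chi (l - n))"

text \<open>The strict inequality forces progress whenever a larger breakpoint exists. A largest
  breakpoint has a successor of equal value, which gives a degenerate cell.\<close>

definition is_next :: "nat \<Rightarrow> nat \<Rightarrow> bool" where
  "is_next l m \<longleftrightarrow> m < 2 * n + 1 \<and> node l \<le> node m \<and>
     (\<forall>h < 2 * n + 1. node h \<le> node l \<or> node l < node m \<and> node m \<le> node h)"

text \<open>Edges with an end beyond the line a = b are exempt, since weak duality needs
  \<open>b \<le> a\<close>.\<close>

definition edge_ok :: "real \<Rightarrow> nat \<Rightarrow> nat \<Rightarrow> nat \<Rightarrow> nat \<Rightarrow> bool" where
  "edge_ok M i j i' j' \<longleftrightarrow> (node j \<le> node i \<longrightarrow> node j' \<le> node i' \<longrightarrow>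
     crossing_le M (bound_lo (node i) (node j)) (bound_hi (node i) (node j))
       (bound_lo (node i') (node j')) (bound_hi (node i') (node j')))"

lemma edge_ok_mono: "edge_ok M i j i' j' \<Longrightarrow> M \<le> M' \<Longrightarrow> edge_ok M' i j i' j'"
  by (auto simp: edge_ok_def intro: crossing_le_mono)

lemma edge_ok_self:
  assumes "edge_ok M i j i j" "node j \<le> node i"
  shows "min (bound_lo (node i) (node j)) (bound_hi (node i) (node j)) \<le> M"
  by (rule crossing_le_self) (use assms in \<open>simp add: edge_ok_def\<close>)

lemma cost_is_node:
  assumes "i \<in> {1..n}"
  shows "clo i = node i" "i < 2 * n + 1" "chi i = node (n + i)" "n + i < 2 * n + 1"
  using assms by (auto simp: node_def)

lemma is_next_gap:
  assumes "is_next l m" "i \<in> {1..n}"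
  shows "clo i \<le> node l \<or> node m \<le> clo i" "chi i \<le> node l \<or> node m \<le> chi i"
proof -
  have "node h \<le> node l \<or> node m \<le> node h" if "h < 2 * n + 1" for h
    using assms(1) that unfolding is_next_def by blast
  then show "clo i \<le> node l \<or> node m \<le> clo i" "chi i \<le> node l \<or> node m \<le> chi i"
    using cost_is_node[OF assms(2)] by simp_all
qed

lemma node_cell:
  assumes nxt: "\<And>l. l < 2 * n + 1 \<Longrightarrow> is_next l (nx l)"
    and a: "0 \<le> a" "h < 2 * n + 1" "a \<le> node h"
  obtains i where "i < 2 * n + 1" "node i \<le> a" "a \<le> node (nx i)"
proof -
  let ?S = "{l. l < 2 * n + 1 \<and> node l \<le> a}"
  have "finite ?S" by (rule finite_subset[of _ "{..<2 * n + 1}"]) auto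
  moreover have "0 \<in> ?S" using a by (simp add: node_def)
  ultimately have "Max (node ` ?S) \<in> node ` ?S" by (intro Max_in) auto
  then obtain i where i: "i \<in> ?S" "node i = Max (node ` ?S)" by auto
  have i_max: "node l \<le> node i" if "l < 2 * n + 1" "node l \<le> a" for l
    using i \<open>finite ?S\<close> that by auto
  have i': "i < 2 * n + 1" "node i \<le> a" using i by auto
  note succ = nxt[OF i'(1), unfolded is_next_def]
  have "a \<le> node (nx i)"
  proof (rule ccontr)
    assume *: "\<not> a \<le> node (nx i)"
    \<comment> \<open>By the choice of \<open>i\<close> the successor makes no progress, so no
      breakpoint exceeds \<open>node i\<close>, which contradicts
      \<open>a \<le> node h\<close>.\<close>
    have "node (nx i) \<le> node i" using i_max[of "nx i"] succ * by simp
    moreover have "node h \<le> node i \<or> node i < node (nx i)" using succ a(2) by blast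
    ultimately have "node h \<le> node i" by linarith
    then show False using a(3) * succ by linarith
  qed
  then show thesis using that i' by blast
qed

text \<open>The diagonal from \<open>(i, j)\<close> to \<open>(nx i, nx j)\<close> splits a grid cell into two triangles, on each of
  which both arguments of the minimum are affine. A cell on the line \<open>a = b\<close> contributes only the
  triangle below that line.\<close>

lemma bound_le_if_edges_ok:
  assumes nxt: "\<And>l. l < 2 * n + 1 \<Longrightarrow> is_next l (nx l)"
    and ok: "\<And>i j. i < 2 * n + 1 \<Longrightarrow> j < 2 * n + 1 \<Longrightarrow>
      edge_ok M i j i j \<and> edge_ok M i j (nx i) j \<and> edge_ok M i j (nx i) (nx j) \<and> edge_ok M i j i (nx j)"
    and ab: "0 \<le> b" "b \<le> a" "h < 2 * n + 1" "a \<le> node h"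
  shows "bound a b \<le> M"
proof -
  obtain i where i: "i < 2 * n + 1" "node i \<le> a" "a \<le> node (nx i)"
    using node_cell[OF nxt order_trans[OF ab(1,2)] ab(3,4)] by blast
  \<comment> \<open>Reusing \<open>i\<close> when both prices share its cell puts them on the same
    segment, so that \<open>r\<close> and \<open>s\<close> become comparable.\<close>
  obtain j where j: "j < 2 * n + 1" "node j \<le> b" "b \<le> node (nx j)" "j = i \<or> node j < node i"
  proof (cases "node i \<le> b")
    case True
    then show thesis using that[of i] i ab by auto
  next
    case False
    obtain j where "j < 2 * n + 1" "node j \<le> b" "b \<le> node (nx j)"
      using node_cell[OF nxt ab(1,3) order_trans[OF ab(2,4)]] by blast
    then show thesis using that[of j] False by auto
  qed
  obtain r where r: "0 \<le> r" "r \<le> 1" "a = node i + r * (node (nx i) - node i)"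
    "r = (a - node i) / (node (nx i) - node i)"
    using segment_coordinate i by blast
  obtain s where s: "0 \<le> s" "s \<le> 1" "b = node j + s * (node (nx j) - node j)"
    "s = (b - node j) / (node (nx j) - node j)"
    using segment_coordinate j by blast
  note ni = nxt[OF i(1)] and nj = nxt[OF j(1)]
  have ni': "nx i < 2 * n + 1" "node i \<le> node (nx i)" and nj': "nx j < 2 * n + 1" "node j \<le> node (nx j)"
    using ni nj by (auto simp: is_next_def)
  have dual: "dual c a b = old_part c (node i) + r * (old_part c (node (nx i)) - old_part c (node i))
      + new_part c (node j) + s * (new_part c (node (nx j)) - new_part c (node j))"
    if "c = clo \<or> c = chi" for c
  proof -
    have gap: "c l \<le> node i \<or> node (nx i) \<le> c l" "c l \<le> node j \<or> node (nx j) \<le> c l"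
      if "l \<in> {1..n}" for l
      using is_next_gap[OF ni that] is_next_gap[OF nj that] \<open>c = clo \<or> c = chi\<close> by auto
    have "old_part c a = old_part c (node i) + r * (old_part c (node (nx i)) - old_part c (node i))"
      by (subst r(3)) (rule old_part_linear[OF r(1,2) ni'(2) gap(1)])
    moreover have "new_part c b = new_part c (node j) + s * (new_part c (node (nx j)) - new_part c (node j))"
      by (subst s(3)) (rule new_part_linear[OF s(1,2) nj'(2) gap(2)])
    ultimately show ?thesis by (simp add: dual_def)
  qed
  have segs: "segment_le M (bound_lo (node i1) (node j1)) (bound_hi (node i1) (node j1))
      (bound_lo (node i2) (node j2)) (bound_hi (node i2) (node j2))"
    if "edge_ok M i1 j1 i2 j2" "node j1 \<le> node i1" "node j2 \<le> node i2"
      "i1 < 2 * n + 1" "j1 < 2 * n + 1" "i2 < 2 * n + 1" "j2 < 2 * n + 1" for i1 j1 i2 j2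
    using that(1-3) edge_ok_self[OF ok[OF that(4,5), THEN conjunct1] that(2)]
      edge_ok_self[OF ok[OF that(6,7), THEN conjunct1] that(3)]
    by (simp add: segment_le_def edge_ok_def)
  have ji: "node j \<le> node i" using j(4) by auto
  show ?thesis
  proof (cases "s \<le> r")
    case True
    have n: "node (nx j) \<le> node (nx i)" 
      using j(4) nj ni' i(1) by (force simp: is_next_def)
    \<comment> \<open>The side opposite to the corner \<open>(i, j)\<close> is checked as a side of
      the next cell, the one at \<open>(nx i, j)\<close>; hence three proper edges per grid point
      suffice. The weights that follow are the barycentric coordinates in the triangle.\<close>
    have e: "edge_ok M i j (nx i) j" "edge_ok M i j (nx i) (nx j)" "edge_ok M (nx i) j (nx i) (nx j)"
      using ok[OF i(1) j(1)] ok[OF ni'(1) j(1)] by auto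
    have "min ((1 - r) * bound_lo (node i) (node j) + (r - s) * bound_lo (node (nx i)) (node j)
          + s * bound_lo (node (nx i)) (node (nx j)))
        ((1 - r) * bound_hi (node i) (node j) + (r - s) * bound_hi (node (nx i)) (node j)
          + s * bound_hi (node (nx i)) (node (nx j))) \<le> M"
      using True r(1,2) s(1,2) ji n ni'(2) order_trans[OF ji ni'(2)] i(1) j(1) ni'(1) nj'(1)
      by (intro triangle_le segs[OF e(1)] segs[OF e(2)] segs[OF e(3)]) simp_all
    then show ?thesis
      by (simp add: bound_def dual) (simp add: dual_def algebra_simps)
  next
    case False
    \<comment> \<open>In a common cell \<open>b \<le> a\<close> would give \<open>s \<le> r\<close>.
      So the cell of \<open>b\<close> starts strictly lower, and its upper end is still at most
      \<open>node i\<close>.\<close>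
    then have "node j < node i"
      using j(4) r(4) s(4) ab ni'(2) by (auto simp: divide_right_mono)
    then have n: "node (nx j) \<le> node i"
      using nj i(1) by (force simp: is_next_def)
    have e: "edge_ok M i j i (nx j)" "edge_ok M i j (nx i) (nx j)" "edge_ok M i (nx j) (nx i) (nx j)"
      using ok[OF i(1) j(1)] ok[OF i(1) nj'(1)] by auto
    have "min ((1 - s) * bound_lo (node i) (node j) + (s - r) * bound_lo (node i) (node (nx j))
          + r * bound_lo (node (nx i)) (node (nx j)))
        ((1 - s) * bound_hi (node i) (node j) + (s - r) * bound_hi (node i) (node (nx j))
          + r * bound_hi (node (nx i)) (node (nx j))) \<le> M"
      using False r(1,2) s(1,2) ji n ni'(2) order_trans[OF ji ni'(2)] i(1) j(1) ni'(1) nj'(1)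
      by (intro triangle_le segs[OF e(1)] segs[OF e(2)] segs[OF e(3)]) simp_all
    then show ?thesis
      by (simp add: bound_def dual) (simp add: dual_def algebra_simps)
  qed
qed

end

section \<open>Timed correctness of programs\<close>

text \<open>Upper bound on the running time when every loop makes at most \<open>N\<close> iterations.\<close>

fun cost_bound :: "nat \<Rightarrow> com \<Rightarrow> nat" where
  "cost_bound N Skip = 1"
| "cost_bound N (NStore a i e) = 1 + ncost i + ncost e"
| "cost_bound N (RStore a i e) = 1 + ncost i + rcost e"
| "cost_bound N (Seq c d) = cost_bound N c + cost_bound N d"
| "cost_bound N (If b c d) = bcost b + cost_bound N c + cost_bound N d"
| "cost_bound N (While b c) = (N + 1) * (bcost b + cost_bound N c)"

fun loop_depth :: "com \<Rightarrow> nat" where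
  "loop_depth (Seq c d) = max (loop_depth c) (loop_depth d)"
| "loop_depth (If b c d) = max (loop_depth c) (loop_depth d)"
| "loop_depth (While b c) = Suc (loop_depth c)"
| "loop_depth _ = 0"

text \<open>At \<open>N = 0\<close> every loop counts once, so \<open>cost_bound 0 c\<close> serves
  as the constant, and each nesting level adds a factor \<open>N + 1\<close>.\<close>

lemma cost_bound_poly: "cost_bound N c \<le> cost_bound 0 c * (N + 1) ^ loop_depth c"
proof (induction c)
  case (Seq c d)
  have "cost_bound 0 c * (N + 1) ^ loop_depth c \<le> cost_bound 0 c * (N + 1) ^ loop_depth (Seq c d)"
    "cost_bound 0 d * (N + 1) ^ loop_depth d \<le> cost_bound 0 d * (N + 1) ^ loop_depth (Seq c d)"
    by (intro mult_left_mono power_increasing; simp)+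
  with Seq.IH show ?case
    unfolding cost_bound.simps(4) add_mult_distrib by linarith
next
  case (If b c d)
  have "cost_bound 0 c * (N + 1) ^ loop_depth c \<le> cost_bound 0 c * (N + 1) ^ loop_depth (If b c d)"
    "cost_bound 0 d * (N + 1) ^ loop_depth d \<le> cost_bound 0 d * (N + 1) ^ loop_depth (If b c d)"
    "bcost b * 1 \<le> bcost b * (N + 1) ^ loop_depth (If b c d)"
    by (intro mult_left_mono power_increasing; simp)+
  with If.IH show ?case
    unfolding cost_bound.simps(5) add_mult_distrib by linarith
next
  case (While b c)
  have "bcost b * 1 \<le> bcost b * (N + 1) ^ loop_depth c" by (intro mult_left_mono) auto
  with While.IH have "bcost b + cost_bound N c \<le> (bcost b + cost_bound 0 c) * (N + 1) ^ loop_depth c"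
    unfolding add_mult_distrib by linarith
  then have "(N + 1) * (bcost b + cost_bound N c)
      \<le> (N + 1) * ((bcost b + cost_bound 0 c) * (N + 1) ^ loop_depth c)"
    by (rule mult_left_mono) simp
  then show ?case
    by (simp only: cost_bound.simps loop_depth.simps power_Suc mult_ac add_0 mult_1)
qed auto

text \<open>Total correctness with a time bound read off the program text, so that no invariant has
  to mention time.\<close>

definition triple :: "nat \<Rightarrow> (state \<Rightarrow> bool) \<Rightarrow> com \<Rightarrow> (state \<Rightarrow> bool) \<Rightarrow> bool" where
  "triple N A c B \<longleftrightarrow> (\<forall>s. A s \<longrightarrow> (\<exists>t s'. exec c s t s' \<and> t \<le> cost_bound N c \<and> B s'))"

lemma tripleI: "(\<And>s. A s \<Longrightarrow> \<exists>t s'. exec c s t s' \<and> t \<le> cost_bound N c \<and> B s') \<Longrightarrow> triple N A c B"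
  by (simp add: triple_def)

lemma tripleE:
  assumes "triple N A c B" "A s"
  obtains t s' where "exec c s t s'" "t \<le> cost_bound N c" "B s'"
  using assms by (auto simp: triple_def)

lemma triple_mono:
  assumes "triple N A c B" "\<And>s. A' s \<Longrightarrow> A s" "\<And>s. B s \<Longrightarrow> B' s"
  shows "triple N A' c B'"
  using assms unfolding triple_def by meson

lemma triple_Seq:
  assumes "triple N A c B" "triple N B d C"
  shows "triple N A (Seq c d) C"
proof (rule tripleI)
  fix s assume "A s"
  then obtain t s' where 1: "exec c s t s'" "t \<le> cost_bound N c" "B s'"
    using assms(1) by (elim tripleE)
  then obtain t' s'' where 2: "exec d s' t' s''" "t' \<le> cost_bound N d" "C s''"
    using assms(2) by (elim tripleE)
  show "\<exists>t s'. exec (Seq c d) s t s' \<and> t \<le> cost_bound N (Seq c d) \<and> C s'"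
    using exec.Seq[OF 1(1) 2(1)] 1 2 by (intro exI[of _ "t + t'"] exI[of _ s'']) simp
qed

fun loop_free :: "com \<Rightarrow> bool" where
  "loop_free (Seq c d) \<longleftrightarrow> loop_free c \<and> loop_free d"
| "loop_free (If b c d) \<longleftrightarrow> loop_free c \<and> loop_free d"
| "loop_free (While b c) \<longleftrightarrow> False"
| "loop_free _ \<longleftrightarrow> True"

text \<open>Turns loop-free code into a function that simplification can evaluate. The value on a
  loop is a placeholder, ruled out by \<open>loop_free\<close>.\<close>

fun step :: "com \<Rightarrow> state \<Rightarrow> state" where
  "step Skip s = s"
| "step (NStore a i e) s = nwrite a (nval i s) (nval e s) s"
| "step (RStore a i e) s = rwrite a (nval i s) (rval e s) s"
| "step (Seq c d) s = step d (step c s)"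
| "step (If b c d) s = (if bval b s then step c s else step d s)"
| "step (While b c) s = s"

lemma exec_step: "loop_free c \<Longrightarrow> \<exists>t \<le> cost_bound N c. exec c s t (step c s)"
proof (induction c arbitrary: s)
  case (Seq c d)
  then obtain t u where "t \<le> cost_bound N c" "exec c s t (step c s)"
    "u \<le> cost_bound N d" "exec d (step c s) u (step d (step c s))"
    by (meson loop_free.simps(1))
  then show ?case by (intro exI[of _ "t + u"]) (auto intro: exec.Seq)
next
  case (If b c d)
  then obtain t u where "t \<le> cost_bound N c" "exec c s t (step c s)"
    "u \<le> cost_bound N d" "exec d s u (step d s)"
    by (meson loop_free.simps(2))
  then show ?case
    using exec.IfTrue[of b s c t "step c s" d] exec.IfFalse[of b s d u "step d s" c]
    by (cases "bval b s")
      (auto intro: exI[of _ "bcost b + t"] exI[of _ "bcost b + u"])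
next
  case Skip
  show ?case using exec.Skip by auto
next
  case (NStore a i e)
  show ?case using exec.NStore by auto
next
  case (RStore a i e)
  show ?case using exec.RStore by auto
qed simp

lemma triple_step:
  assumes "loop_free c" "\<And>s. A s \<Longrightarrow> B (step c s)"
  shows "triple N A c B"
  using assms exec_step[of c N] by (fastforce intro!: tripleI)

abbreviation nvar :: "name \<Rightarrow> nexp" where "nvar a \<equiv> NLoad a (NConst 0)"
abbreviation rvar :: "name \<Rightarrow> rexp" where "rvar a \<equiv> RLoad a (NConst 0)"
abbreviation nset :: "name \<Rightarrow> nexp \<Rightarrow> com" where "nset a e \<equiv> NStore a (NConst 0) e"
abbreviation rset :: "name \<Rightarrow> rexp \<Rightarrow> com" where "rset a e \<equiv> RStore a (NConst 0) e"
notation Seq (infixr \<open>;;\<close> 60)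

definition for_loop :: "name \<Rightarrow> nexp \<Rightarrow> com \<Rightarrow> com" where
  "for_loop i e c = nset i (NConst 0) ;;
     While (NLess (nvar i) e) (c ;; nset i (NAdd (nvar i) (NConst 1)))"

lemma loop_depth_for_loop [simp]: "loop_depth (for_loop i e c) = Suc (loop_depth c)"
  by (simp add: for_loop_def)

lemma nmem_nwrite [simp]: "nmem (nwrite a i m s) = (nmem s)(a := (nmem s a)(i := m))"
  and rmem_nwrite [simp]: "rmem (nwrite a i m s) = rmem s"
  and nmem_rwrite [simp]: "nmem (rwrite a i r s) = nmem s"
  and rmem_rwrite [simp]: "rmem (rwrite a i r s) = (rmem s)(a := (rmem s a)(i := r))"
  by (simp_all add: nwrite_def rwrite_def)

text \<open>The counter is written outside the body, so the invariant has to tolerate such writes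
  and its value is tied to \<open>m\<close> separately. The bound \<open>e\<close> is evaluated anew
  at every test, hence \<open>size\<close>.\<close>

lemma triple_for_loop:
  assumes body: "\<And>m. m < K \<Longrightarrow>
      triple N (\<lambda>s. I m s \<and> nmem s i 0 = m) c (\<lambda>s. I (Suc m) s \<and> nmem s i 0 = m)"
    and counter: "\<And>m l s. I m s \<Longrightarrow> I m (nwrite i 0 l s)"
    and size: "\<And>m s. I m s \<Longrightarrow> nval e s = K" and "K \<le> N"
  shows "triple N (I 0) (for_loop i e c) (I K)"
proof (rule tripleI)
  fix s assume "I 0 s"
  let ?b = "NLess (nvar i) e" and ?c = "c ;; nset i (NAdd (nvar i) (NConst 1))"
  \<comment> \<open>\<open>K - m\<close> iterations remain, followed by one failing test; the factor
    \<open>N + 1\<close> in \<open>cost_bound\<close> pays for that test.\<close>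
  have loop: "\<exists>t s'. exec (While ?b ?c) s t s' \<and> t \<le> (K - m) * (bcost ?b + cost_bound N ?c) + bcost ?b \<and> I K s'"
    if "m \<le> K" "I m s" "nmem s i 0 = m" for m s
    using that
  proof (induction m arbitrary: s rule: inc_induct)
    case base
    then have "\<not> bval ?b s" using size by simp
    then show ?case using exec.WhileFalse base by fastforce
  next
    case (step m)
    obtain t s1 where 1: "exec c s t s1" "t \<le> cost_bound N c" "I (Suc m) s1" "nmem s1 i 0 = m"
      using tripleE[OF body[OF step.hyps(2)], of s] step.prems by blast
    let ?s2 = "nwrite i 0 (Suc m) s1"
    have "exec (nset i (NAdd (nvar i) (NConst 1))) s1
        (cost_bound N (nset i (NAdd (nvar i) (NConst 1)))) ?s2"
      using exec.NStore[of i "NConst 0" "NAdd (nvar i) (NConst 1)" s1] 1(4) by simp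
    from exec.Seq[OF 1(1) this] obtain u where u: "exec ?c s u ?s2" "u \<le> cost_bound N ?c"
      using 1(2) by auto
    obtain t' s' where 2: "exec (While ?b ?c) ?s2 t' s'"
      "t' \<le> (K - Suc m) * (bcost ?b + cost_bound N ?c) + bcost ?b" "I K s'"
      using step.IH[of ?s2] counter[OF 1(3)] by auto
    have "bval ?b s" using step.prems step.hyps size by simp
    from exec.WhileTrue[OF this u(1) 2(1)] have "exec (While ?b ?c) s (bcost ?b + u + t') s'" .
    moreover have "K - m = Suc (K - Suc m)" using step.hyps by simp
    then have "bcost ?b + u + t' \<le> (K - m) * (bcost ?b + cost_bound N ?c) + bcost ?b"
      using u(2) 2(2) by (simp only: mult_Suc)
    ultimately show ?case using 2(3) by blast
  qed
  obtain t s' where 1: "exec (While ?b ?c) (nwrite i 0 0 s) t s'"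
    "t \<le> (K - 0) * (bcost ?b + cost_bound N ?c) + bcost ?b" "I K s'"
    using loop[of 0 "nwrite i 0 0 s"] counter[OF \<open>I 0 s\<close>] by auto
  have "exec (nset i (NConst 0)) s 3 (nwrite i 0 0 s)"
    using exec.NStore[of i "NConst 0" "NConst 0" s] by (simp add: numeral_3_eq_3)
  from exec.Seq[OF this 1(1)] have "exec (for_loop i e c) s (3 + t) s'"
    by (simp add: for_loop_def)
  moreover have "K * (bcost ?b + cost_bound N ?c) \<le> N * (bcost ?b + cost_bound N ?c)"
    using \<open>K \<le> N\<close> by (rule mult_right_mono) simp
  then have "3 + t \<le> cost_bound N (for_loop i e c)"
    using 1(2) by (simp add: for_loop_def)
  ultimately show "\<exists>t s'. exec (for_loop i e c) s t s' \<and> t \<le> cost_bound N (for_loop i e c) \<and> I K s'"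
    using 1(3) by blast
qed

section \<open>The program\<close>

abbreviation item :: nexp where "item \<equiv> NAdd (nvar ''i'') (NConst 1)"
abbreviation node_count :: nexp where "node_count \<equiv> NAdd (NAdd (nvar ''n'') (nvar ''n'')) (NConst 1)"
abbreviation in_x :: bexp where "in_x \<equiv> NLess (NConst 0) (NLoad ''x'' item)"

definition fill_nodes :: com where
  "fill_nodes = RStore ''node'' (NConst 0) (RNat (NConst 0)) ;;
     for_loop ''i'' (nvar ''n'')
       (RStore ''node'' item (RLoad ''clo'' item) ;;
        RStore ''node'' (NAdd (nvar ''n'') item) (RLoad ''chi'' item))"

definition subtract_hinge :: "name \<Rightarrow> name \<Rightarrow> com" where
  "subtract_hinge v c = If (RLess (RLoad c item) (rvar ''a''))
     (rset v (RSub (rvar v) (RSub (rvar ''a'') (RLoad c item)))) Skip"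

definition init_entry :: com where
  "init_entry = nset ''nx'' (nvar ''j'') ;; rset ''a'' (RLoad ''node'' (nvar ''j'')) ;;
     rset ''A'' (RMul (RNat (NSub (nvar ''p'') (nvar ''k''))) (rvar ''a'')) ;;
     rset ''A2'' (rvar ''A'') ;;
     rset ''B'' (RMul (RNat (nvar ''k'')) (rvar ''a'')) ;;
     rset ''B2'' (rvar ''B'')"

definition entry_item :: com where
  "entry_item = If in_x (subtract_hinge ''A'' ''clo'' ;; subtract_hinge ''A2'' ''chi'')
     (subtract_hinge ''B'' ''clo'' ;; subtract_hinge ''B2'' ''chi'')"

text \<open>The candidate \<open>nx\<close> starts as \<open>j\<close> itself, standing for no
  larger breakpoint found so far; hence the test whether it already exceeds
  \<open>a\<close>.\<close>

definition entry_next :: com where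
  "entry_next = If (BAnd (RLess (rvar ''a'') (RLoad ''node'' (nvar ''i'')))
       (BNot (BAnd (RLess (rvar ''a'') (RLoad ''node'' (nvar ''nx'')))
         (RLess (RLoad ''node'' (nvar ''nx'')) (RLoad ''node'' (nvar ''i''))))))
     (nset ''nx'' (nvar ''i'')) Skip"

text \<open>With \<open>\<Gamma>\<close> added once per entry, \<open>oldlo\<close> plus
  \<open>newlo\<close> is directly the first argument of the minimum.\<close>

definition store_entry :: com where
  "store_entry = RStore ''oldlo'' (nvar ''j'') (rvar ''A'') ;;
     RStore ''oldhi'' (nvar ''j'') (rvar ''A2'') ;;
     RStore ''newlo'' (nvar ''j'') (RAdd (rvar ''B'') (rvar ''Gamma'')) ;;
     RStore ''newhi'' (nvar ''j'') (rvar ''B2'') ;;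
     NStore ''next'' (nvar ''j'') (nvar ''nx'')"

definition fill_tables :: com where
  "fill_tables = for_loop ''j'' node_count
     (init_entry ;; for_loop ''i'' (nvar ''n'') entry_item ;;
      for_loop ''i'' node_count entry_next ;; store_entry)"

definition mix :: "rexp \<Rightarrow> rexp \<Rightarrow> rexp" where
  "mix e f = RAdd e (RMul (rvar ''r'') (RSub f e))"

definition eval_edge :: com where
  "eval_edge =
     rset ''P'' (RAdd (RLoad ''oldlo'' (nvar ''i'')) (RLoad ''newlo'' (nvar ''j''))) ;;
     rset ''Q'' (RAdd (RLoad ''oldhi'' (nvar ''i'')) (RLoad ''newhi'' (nvar ''j''))) ;;
     rset ''P2'' (RAdd (RLoad ''oldlo'' (nvar ''i2'')) (RLoad ''newlo'' (nvar ''j2''))) ;;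
     rset ''Q2'' (RAdd (RLoad ''oldhi'' (nvar ''i2'')) (RLoad ''newhi'' (nvar ''j2''))) ;;
     rset ''r'' (RDiv (RSub (rvar ''P'') (rvar ''Q''))
       (RSub (RSub (rvar ''P'') (rvar ''Q'')) (RSub (rvar ''P2'') (rvar ''Q2'')))) ;;
     rset ''P'' (mix (rvar ''P'') (rvar ''P2'')) ;;
     rset ''Q'' (mix (rvar ''Q'') (rvar ''Q2'')) ;;
     If (RLess (rvar ''Q'') (rvar ''P'')) (rset ''P'' (rvar ''Q'')) Skip "

definition try_edge :: com where
  "try_edge = eval_edge ;;
     If (BAnd (BNot (RLess (RLoad ''node'' (nvar ''i'')) (RLoad ''node'' (nvar ''j''))))
         (BAnd (BNot (RLess (RLoad ''node'' (nvar ''i2'')) (RLoad ''node'' (nvar ''j2''))))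
         (BAnd (BNot (RLess (rvar ''r'') (RNat (NConst 0))))
         (BAnd (BNot (RLess (RNat (NConst 1)) (rvar ''r'')))
           (RLess (rvar ''v'') (rvar ''P''))))))
       (rset ''v'' (rvar ''P'') ;;
        rset ''a'' (mix (RLoad ''node'' (nvar ''i'')) (RLoad ''node'' (nvar ''i2''))) ;;
        rset ''b'' (mix (RLoad ''node'' (nvar ''j'')) (RLoad ''node'' (nvar ''j2''))))
       Skip"

text \<open>The far end moves in one coordinate at a time: the grid point itself, the step in the
  first price, the diagonal, the step in the second price.\<close>

definition try_edges :: com where
  "try_edges = nset ''i2'' (nvar ''i'') ;; nset ''j2'' (nvar ''j'') ;; try_edge ;;
     nset ''i2'' (NLoad ''next'' (nvar ''i'')) ;; try_edge ;;
     nset ''j2'' (NLoad ''next'' (nvar ''j'')) ;; try_edge ;;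
     nset ''i2'' (nvar ''i'') ;; try_edge"

definition search :: com where
  "search = (rset ''v'' (RNat (NConst 0)) ;; rset ''a'' (RNat (NConst 0)) ;; rset ''b'' (RNat (NConst 0))) ;;
     for_loop ''i'' node_count (for_loop ''j'' node_count try_edges)"

definition raise_item :: com where
  "raise_item = If in_x (rset ''t'' (rvar ''a'')) (rset ''t'' (rvar ''b'')) ;;
     If (RLess (RLoad ''clo'' item) (rvar ''t''))
       (If (RLess (RLoad ''chi'' item) (rvar ''t''))
         (RStore ''c'' item (RSub (RLoad ''chi'' item) (RLoad ''clo'' item)))
         (RStore ''c'' item (RSub (rvar ''t'') (RLoad ''clo'' item))))
       (RStore ''c'' item (RNat (NConst 0))) ;;
     rset ''W'' (RAdd (rvar ''W'') (RLoad ''c'' item))"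

text \<open>The array \<open>c\<close> first holds the raises, since scaling needs their total, and
  is then overwritten by the scenario.\<close>

definition output_scenario :: com where
  "output_scenario = rset ''W'' (RNat (NConst 0)) ;;
     for_loop ''i'' (nvar ''n'') raise_item ;;
     If (RLess (rvar ''Gamma'') (rvar ''W'')) (rset ''r'' (RDiv (rvar ''Gamma'') (rvar ''W'')))
       (rset ''r'' (RNat (NConst 1))) ;;
     for_loop ''i'' (nvar ''n'')
       (RStore ''c'' item (RAdd (RLoad ''clo'' item) (RMul (rvar ''r'') (RLoad ''c'' item))))"

definition arec_program :: com where
  "arec_program = fill_nodes ;; fill_tables ;; search ;; output_scenario"

lemma excess_0 [simp]: "excess S 0 c a = 0"
  and excess_Suc [simp]: "excess S (Suc m) c a = excess S m c a + (if S (Suc m) then max 0 (a - c (Suc m)) else 0)"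
  by (simp_all add: excess_def)

section \<open>Correctness of the program: input and breakpoints\<close>

context arec
begin

definition input :: "state \<Rightarrow> bool" where
  "input s \<longleftrightarrow> nmem s ''n'' 0 = n \<and> nmem s ''p'' 0 = p \<and> nmem s ''k'' 0 = k \<and>
     rmem s ''Gamma'' 0 = \<Gamma> \<and>
     (\<forall>i\<in>{1..n}. nmem s ''x'' i = x i \<and> rmem s ''clo'' i = clo i \<and> rmem s ''chi'' i = chi i)"

lemma input_arec_input: "input (arec_input n p k x clo chi \<Gamma>)"
  by (simp add: input_def arec_input_def)

lemma inputD:
  assumes "input s"
  shows "nmem s ''n'' 0 = n" "nmem s ''p'' 0 = p" "nmem s ''k'' 0 = k" "rmem s ''Gamma'' 0 = \<Gamma>"
    "m < n \<Longrightarrow> nmem s ''x'' (Suc m) = x (Suc m)" "m < n \<Longrightarrow> rmem s ''clo'' (Suc m) = clo (Suc m)"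
    "m < n \<Longrightarrow> rmem s ''chi'' (Suc m) = chi (Suc m)"
  using assms by (auto simp: input_def)

text \<open>Frame rules of this kind let simplification carry assertions past writes to unrelated
  arrays.\<close>

lemma input_nwrite [simp]:
  "a \<notin> {''n'', ''p'', ''k'', ''x''} \<Longrightarrow> input (nwrite a i m s) \<longleftrightarrow> input s"
  by (auto simp: input_def)

lemma input_rwrite [simp]:
  "a \<notin> {''Gamma'', ''clo'', ''chi''} \<Longrightarrow> input (rwrite a i r s) \<longleftrightarrow> input s"
  by (auto simp: input_def)

definition nodes :: "state \<Rightarrow> bool" where
  "nodes s \<longleftrightarrow> input s \<and> (\<forall>l < 2 * n + 1. rmem s ''node'' l = node l)"

lemma nodes_nwrite [simp]:
  "a \<notin> {''n'', ''p'', ''k'', ''x''} \<Longrightarrow> nodes (nwrite a i m s) \<longleftrightarrow> nodes s"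
  by (auto simp: nodes_def)

lemma nodes_rwrite [simp]:
  "a \<notin> {''Gamma'', ''clo'', ''chi'', ''node''} \<Longrightarrow> nodes (rwrite a i r s) \<longleftrightarrow> nodes s"
  by (auto simp: nodes_def)

lemma fill_nodes: "triple (2 * n + 1) input fill_nodes nodes"
proof -
  let ?I = "\<lambda>m s. input s \<and> rmem s ''node'' 0 = 0 \<and>
    (\<forall>l. 1 \<le> l \<and> l \<le> m \<longrightarrow> rmem s ''node'' l = clo l \<and> rmem s ''node'' (n + l) = chi l)"
  have "triple (2 * n + 1) input fill_nodes (?I n)"
    unfolding fill_nodes_def
  proof (rule triple_Seq)
    show "triple (2 * n + 1) input (RStore ''node'' (NConst 0) (RNat (NConst 0))) (?I 0)"
      by (rule triple_step) auto
    show "triple (2 * n + 1) (?I 0) (for_loop ''i'' (nvar ''n'')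
       (RStore ''node'' item (RLoad ''clo'' item) ;;
        RStore ''node'' (NAdd (nvar ''n'') item) (RLoad ''chi'' item))) (?I n)"
      by (rule triple_for_loop; (rule triple_step)?) (auto simp: inputD le_Suc_eq)
  qed
  moreover have "nodes s" if "?I n s" for s
    unfolding nodes_def
  proof (intro conjI allI impI)
    fix l assume "l < 2 * n + 1"
    show "rmem s ''node'' l = node l"
    proof (cases "l = 0 \<or> l \<le> n")
      case True
      then show ?thesis using that by (auto simp: node_def)
    next
      case False
      then have "rmem s ''node'' (n + (l - n)) = chi (l - n)"
        using that \<open>l < 2 * n + 1\<close> by (intro conjunct2[OF that[THEN conjunct2, THEN conjunct2, rule_format]]) auto
      with False show ?thesis by (simp add: node_def)
    qed
  qed (use that in auto)
  ultimately show ?thesis by (auto elim: triple_mono)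
qed

section \<open>Correctness of the tables\<close>

definition tables :: "nat \<Rightarrow> state \<Rightarrow> bool" where
  "tables m s \<longleftrightarrow> nodes s \<and> (\<forall>l < m.
     rmem s ''oldlo'' l = old_part clo (node l) \<and> rmem s ''oldhi'' l = old_part chi (node l) \<and>
     rmem s ''newlo'' l = new_part clo (node l) + \<Gamma> \<and> rmem s ''newhi'' l = new_part chi (node l) \<and>
     is_next l (nmem s ''next'' l))"

lemma tables_nwrite [simp]:
  "a \<notin> {''n'', ''p'', ''k'', ''x'', ''next''} \<Longrightarrow> tables l (nwrite a i m s) \<longleftrightarrow> tables l s"
  by (auto simp: tables_def)

lemma tables_rwrite [simp]:
  "a \<notin> {''Gamma'', ''clo'', ''chi'', ''node'', ''oldlo'', ''oldhi'', ''newlo'', ''newhi''} \<Longrightarrow>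
    tables l (rwrite a i r s) \<longleftrightarrow> tables l s"
  by (auto simp: tables_def)

lemma tablesD: "tables m s \<Longrightarrow> nodes s" "tables m s \<Longrightarrow> input s"
  by (simp_all add: tables_def nodes_def)

lemma nodesD: "nodes s \<Longrightarrow> l < 2 * n + 1 \<Longrightarrow> rmem s ''node'' l = node l" "nodes s \<Longrightarrow> input s"
  by (simp_all add: nodes_def)

definition entry :: "nat \<Rightarrow> nat \<Rightarrow> state \<Rightarrow> bool" where
  "entry j m s \<longleftrightarrow> tables j s \<and> nmem s ''j'' 0 = j \<and> rmem s ''a'' 0 = node j \<and>
     rmem s ''A'' 0 = real (p - k) * node j - excess (\<lambda>i. x i = 1) m clo (node j) \<and>
     rmem s ''A2'' 0 = real (p - k) * node j - excess (\<lambda>i. x i = 1) m chi (node j) \<and>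
     rmem s ''B'' 0 = real k * node j - excess (\<lambda>i. x i \<noteq> 1) m clo (node j) \<and>
     rmem s ''B2'' 0 = real k * node j - excess (\<lambda>i. x i \<noteq> 1) m chi (node j)"

text \<open>The condition of \<open>is_next\<close> restricted to the breakpoints already scanned:
  \<open>j\<close> satisfies it before the scan, and after a full scan it is
  \<open>is_next\<close>.\<close>

definition next_upto :: "nat \<Rightarrow> nat \<Rightarrow> nat \<Rightarrow> bool" where
  "next_upto j m l \<longleftrightarrow> l < 2 * n + 1 \<and> node j \<le> node l \<and>
     (\<forall>h < m. node h \<le> node j \<or> node j < node l \<and> node l \<le> node h)"

lemma init_entry:
  assumes "j < 2 * n + 1"
  shows "triple N (\<lambda>s. tables j s \<and> nmem s ''j'' 0 = j) init_entry
    (\<lambda>s. entry j 0 s \<and> nmem s ''nx'' 0 = j)"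
proof (rule triple_step)
  fix s assume s: "tables j s \<and> nmem s ''j'' 0 = j"
  then have "input s" "nodes s" by (auto dest: tablesD)
  with s assms show "entry j 0 (step init_entry s) \<and> nmem (step init_entry s) ''nx'' 0 = j"
    by (simp add: init_entry_def entry_def inputD nodesD)
qed (simp add: init_entry_def)

lemma entry_item:
  assumes "m < n"
  shows "triple N (\<lambda>s. (entry j m s \<and> nmem s ''nx'' 0 = j) \<and> nmem s ''i'' 0 = m) entry_item
    (\<lambda>s. (entry j (Suc m) s \<and> nmem s ''nx'' 0 = j) \<and> nmem s ''i'' 0 = m)"
proof (rule triple_step)
  fix s assume s: "(entry j m s \<and> nmem s ''nx'' 0 = j) \<and> nmem s ''i'' 0 = m"
  then have "input s" by (auto simp: entry_def dest: tablesD)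
  with s assms x_cases[of "Suc m"]
  show "(entry j (Suc m) (step entry_item s) \<and> nmem (step entry_item s) ''nx'' 0 = j) \<and>
      nmem (step entry_item s) ''i'' 0 = m"
    by (auto simp: entry_item_def subtract_hinge_def entry_def inputD)
qed (simp add: entry_item_def subtract_hinge_def)

lemma entry_next:
  assumes "m < 2 * n + 1"
  shows "triple N (\<lambda>s. (entry j n s \<and> next_upto j m (nmem s ''nx'' 0)) \<and> nmem s ''i'' 0 = m) entry_next
    (\<lambda>s. (entry j n s \<and> next_upto j (Suc m) (nmem s ''nx'' 0)) \<and> nmem s ''i'' 0 = m)"
proof (rule triple_step)
  fix s assume s: "(entry j n s \<and> next_upto j m (nmem s ''nx'' 0)) \<and> nmem s ''i'' 0 = m"
  then have "nodes s" by (auto simp: entry_def dest: tablesD)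
  moreover have "nmem s ''nx'' 0 < 2 * n + 1" using s by (simp add: next_upto_def)
  ultimately have *: "rmem s ''node'' m = node m" "rmem s ''node'' (nmem s ''nx'' 0) = node (nmem s ''nx'' 0)"
    using assms by (simp_all add: nodesD)
  have "next_upto j (Suc m) (nmem (step entry_next s) ''nx'' 0)"
    using s assms unfolding next_upto_def entry_next_def
    by (auto simp: * entry_def less_Suc_eq)
  then show "(entry j n (step entry_next s) \<and> next_upto j (Suc m) (nmem (step entry_next s) ''nx'' 0)) \<and>
      nmem (step entry_next s) ''i'' 0 = m"
    using s by (simp add: entry_next_def entry_def)
qed (simp add: entry_next_def)

lemma store_entry:
  "triple N (\<lambda>s. entry j n s \<and> next_upto j (2 * n + 1) (nmem s ''nx'' 0)) store_entry
    (\<lambda>s. tables (Suc j) s \<and> nmem s ''j'' 0 = j)"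
proof (rule triple_step)
  fix s assume s: "entry j n s \<and> next_upto j (2 * n + 1) (nmem s ''nx'' 0)"
  then have "is_next j (nmem s ''nx'' 0)" "input s" 
    by (auto simp: next_upto_def is_next_def entry_def dest: tablesD)
  then show "tables (Suc j) (step store_entry s) \<and> nmem (step store_entry s) ''j'' 0 = j"
    using s by (auto simp: store_entry_def entry_def tables_def inputD less_Suc_eq old_part_def new_part_def)
qed (simp add: store_entry_def)

lemma fill_tables: "triple (2 * n + 1) nodes fill_tables (tables (2 * n + 1))"
proof -
  have "triple (2 * n + 1) (tables 0) fill_tables (tables (2 * n + 1))"
    unfolding fill_tables_def
  proof (rule triple_for_loop)
    fix j assume j: "j < 2 * n + 1"
    show "triple (2 * n + 1) (\<lambda>s. tables j s \<and> nmem s ''j'' 0 = j)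
      (init_entry ;; for_loop ''i'' (nvar ''n'') entry_item ;; for_loop ''i'' node_count entry_next ;; store_entry)
      (\<lambda>s. tables (Suc j) s \<and> nmem s ''j'' 0 = j)"
    proof (intro triple_Seq)
      show "triple (2 * n + 1) (\<lambda>s. tables j s \<and> nmem s ''j'' 0 = j) init_entry
          (\<lambda>s. entry j 0 s \<and> nmem s ''nx'' 0 = j)"
        by (rule init_entry[OF j])
      have inp: "entry j m s \<Longrightarrow> input s" for m s by (auto simp: entry_def dest: tablesD)
      have entry_i: "entry j m (nwrite ''i'' 0 l s) = entry j m s" for m l s by (simp add: entry_def)
      show "triple (2 * n + 1) (\<lambda>s. entry j 0 s \<and> nmem s ''nx'' 0 = j)
          (for_loop ''i'' (nvar ''n'') entry_item) (\<lambda>s. entry j n s \<and> next_upto j 0 (nmem s ''nx'' 0))"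
      proof -
        have "triple (2 * n + 1) (\<lambda>s. entry j 0 s \<and> nmem s ''nx'' 0 = j)
            (for_loop ''i'' (nvar ''n'') entry_item) (\<lambda>s. entry j n s \<and> nmem s ''nx'' 0 = j)"
          by (rule triple_for_loop[where I = "\<lambda>m s. entry j m s \<and> nmem s ''nx'' 0 = j"];
              (rule entry_item, assumption)?)
            (auto simp: entry_i inputD(1)[OF inp])
        then show ?thesis by (rule triple_mono) (use j in \<open>auto simp: next_upto_def\<close>)
      qed
      show "triple (2 * n + 1) (\<lambda>s. entry j n s \<and> next_upto j 0 (nmem s ''nx'' 0))
          (for_loop ''i'' node_count entry_next) (\<lambda>s. entry j n s \<and> next_upto j (2 * n + 1) (nmem s ''nx'' 0))"
        by (rule triple_for_loop[where I = "\<lambda>m s. entry j n s \<and> next_upto j m (nmem s ''nx'' 0)"];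
            (rule entry_next, assumption)?)
          (auto simp: entry_i inputD(1)[OF inp])
      show "triple (2 * n + 1) (\<lambda>s. entry j n s \<and> next_upto j (2 * n + 1) (nmem s ''nx'' 0)) store_entry
          (\<lambda>s. tables (Suc j) s \<and> nmem s ''j'' 0 = j)"
        by (rule store_entry)
    qed
  qed (auto simp: inputD(1)[OF tablesD(2)])
  then show ?thesis by (rule triple_mono) (auto simp: tables_def)
qed

section \<open>Correctness of the search\<close>

definition edge_P :: "state \<Rightarrow> nat \<Rightarrow> nat \<Rightarrow> real" where
  "edge_P s i j = rmem s ''oldlo'' i + rmem s ''newlo'' j"

definition edge_Q :: "state \<Rightarrow> nat \<Rightarrow> nat \<Rightarrow> real" where
  "edge_Q s i j = rmem s ''oldhi'' i + rmem s ''newhi'' j"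

lemma step_eval_edge:
  fixes s :: state
  defines "i \<equiv> nmem s ''i'' 0" and "j \<equiv> nmem s ''j'' 0" and "i2 \<equiv> nmem s ''i2'' 0" and "j2 \<equiv> nmem s ''j2'' 0"
  defines "r \<equiv> crossing (edge_P s i j) (edge_Q s i j) (edge_P s i2 j2) (edge_Q s i2 j2)"
  shows "nmem (step eval_edge s) = nmem s"
    and "a \<notin> {''P'', ''Q'', ''P2'', ''Q2'', ''r''} \<Longrightarrow> rmem (step eval_edge s) a = rmem s a"
    and "rmem (step eval_edge s) ''r'' 0 = r"
    and "rmem (step eval_edge s) ''P'' 0 = min (edge_P s i j + r * (edge_P s i2 j2 - edge_P s i j))
      (edge_Q s i j + r * (edge_Q s i2 j2 - edge_Q s i j))"
  unfolding assms by (simp_all add: eval_edge_def mix_def edge_P_def edge_Q_def crossing_def min_def)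

text \<open>The lower half of optimality: the recorded prices certify the recorded value. The upper
  half is \<open>covered\<close>.\<close>

definition sound :: "state \<Rightarrow> bool" where
  "sound s \<longleftrightarrow> rmem s ''b'' 0 \<le> rmem s ''a'' 0 \<and> rmem s ''v'' 0 \<le> bound (rmem s ''a'' 0) (rmem s ''b'' 0)"

lemma sound_nwrite [simp]: "sound (nwrite a i m s) \<longleftrightarrow> sound s"
  by (simp add: sound_def)

lemma try_edge:
  assumes s: "tables (2 * n + 1) s" "sound s"
    and ij: "nmem s ''i'' 0 = i" "nmem s ''j'' 0 = j" "nmem s ''i2'' 0 = i2" "nmem s ''j2'' 0 = j2"
    and lt: "i < 2 * n + 1" "j < 2 * n + 1" "i2 < 2 * n + 1" "j2 < 2 * n + 1"
  shows "nmem (step try_edge s) = nmem s" "tables (2 * n + 1) (step try_edge s)" "sound (step try_edge s)"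
    "rmem s ''v'' 0 \<le> rmem (step try_edge s) ''v'' 0"
    "edge_ok (rmem (step try_edge s) ''v'' 0) i j i2 j2"
proof -
  let ?e = "step eval_edge s" and ?f = "step try_edge s"
  define P Q P2 Q2 where PQ: "P = bound_lo (node i) (node j)" "Q = bound_hi (node i) (node j)"
    "P2 = bound_lo (node i2) (node j2)" "Q2 = bound_hi (node i2) (node j2)"
  define r where "r = crossing P Q P2 Q2"
  define M where "M = min (P + r * (P2 - P)) (Q + r * (Q2 - Q))"
  define valid where "valid \<longleftrightarrow> node j \<le> node i \<and> node j2 \<le> node i2 \<and> 0 \<le> r \<and> r \<le> 1"
  define a b where "a = node i + r * (node i2 - node i)" and "b = node j + r * (node j2 - node j)"
  have PQ': "edge_P s i j = P" "edge_Q s i j = Q" "edge_P s i2 j2 = P2" "edge_Q s i2 j2 = Q2"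
    using s(1) lt by (simp_all add: edge_P_def edge_Q_def tables_def PQ dual_def)
  note e = step_eval_edge[where s = s, unfolded ij PQ', folded r_def, folded M_def]
  have "nodes s" using s(1) by (rule tablesD)
  then have nd: "rmem s ''node'' i = node i" "rmem s ''node'' j = node j"
    "rmem s ''node'' i2 = node i2" "rmem s ''node'' j2 = node j2"
    using lt by (simp_all add: nodesD)
  have f: "nmem ?f = nmem s" 
    "c \<notin> {''P'', ''Q'', ''P2'', ''Q2'', ''r'', ''v'', ''a'', ''b''} \<Longrightarrow> rmem ?f c = rmem s c"
    "rmem ?f ''v'' 0 = (if valid \<and> rmem s ''v'' 0 < M then M else rmem s ''v'' 0)"
    "rmem ?f ''a'' 0 = (if valid \<and> rmem s ''v'' 0 < M then a else rmem s ''a'' 0)"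
    "rmem ?f ''b'' 0 = (if valid \<and> rmem s ''v'' 0 < M then b else rmem s ''b'' 0)" for c
    by (auto simp: try_edge_def mix_def e ij nd valid_def a_def b_def not_less)
  show "nmem ?f = nmem s" by (rule f(1))
  show "tables (2 * n + 1) ?f"
    using s(1) by (simp add: tables_def nodes_def input_def f(1,2))
  show "rmem s ''v'' 0 \<le> rmem ?f ''v'' 0" by (simp add: f)
  show "edge_ok (rmem ?f ''v'' 0) i j i2 j2"
    by (auto simp: edge_ok_def crossing_le_def Let_def PQ[symmetric] r_def[symmetric] M_def[symmetric] f valid_def)
  show "sound ?f"
  proof (cases "valid \<and> rmem s ''v'' 0 < M")
    case True
    then have r: "0 \<le> r" "r \<le> 1" by (auto simp: valid_def)
    have "(1 - r) * node j + r * node j2 \<le> (1 - r) * node i + r * node i2"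
      using True r by (intro add_mono mult_left_mono) (auto simp: valid_def)
    then have "b \<le> a" by (simp add: a_def b_def algebra_simps)
    moreover have "M \<le> bound a b"
      unfolding M_def PQ a_def b_def by (rule bound_segment[OF r])
    ultimately show ?thesis using True by (simp add: sound_def f)
  next
    case False
    then show ?thesis using s(2) by (simp only: sound_def f if_False)
  qed
qed

text \<open>Refers to the current best value, which only grows, so an edge once examined stays
  covered.\<close>

definition covered :: "state \<Rightarrow> nat \<Rightarrow> nat \<Rightarrow> bool" where
  "covered s i j \<longleftrightarrow> (let M = rmem s ''v'' 0; nx = nmem s ''next'' in
     edge_ok M i j i j \<and> edge_ok M i j (nx i) j \<and> edge_ok M i j (nx i) (nx j) \<and> edge_ok M i j i (nx j))"

lemma covered_mono:
  "covered s i j \<Longrightarrow> rmem s ''v'' 0 \<le> rmem s' ''v'' 0 \<Longrightarrow> nmem s' ''next'' = nmem s ''next'' \<Longrightarrow> covered s' i j"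
  by (auto simp: covered_def Let_def intro: edge_ok_mono)

lemma covered_nwrite [simp]: "a \<noteq> ''next'' \<Longrightarrow> covered (nwrite a i m s) = covered s"
  by (simp add: covered_def fun_eq_iff)

lemma try_edges:
  assumes s: "tables (2 * n + 1) s" "sound s"
    and ij: "nmem s ''i'' 0 = i" "nmem s ''j'' 0 = j" and lt: "i < 2 * n + 1" "j < 2 * n + 1"
  defines "s' \<equiv> step try_edges s"
  shows "tables (2 * n + 1) s'" "sound s'" "nmem s' ''i'' 0 = i" "nmem s' ''j'' 0 = j"
    "nmem s' ''next'' = nmem s ''next''" "rmem s ''v'' 0 \<le> rmem s' ''v'' 0" "covered s' i j"
proof -
  let ?ni = "nmem s ''next'' i" and ?nj = "nmem s ''next'' j"
  have n: "?ni < 2 * n + 1" "?nj < 2 * n + 1"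
    using s(1) lt by (auto simp: tables_def is_next_def)
  define s1 where "s1 = nwrite ''j2'' 0 j (nwrite ''i2'' 0 i s)"
  define t1 where "t1 = step try_edge s1"
  define s2 where "s2 = nwrite ''i2'' 0 ?ni t1"
  define t2 where "t2 = step try_edge s2"
  define s3 where "s3 = nwrite ''j2'' 0 ?nj t2"
  define t3 where "t3 = step try_edge s3"
  define s4 where "s4 = nwrite ''i2'' 0 i t3"
  have "tables (2 * n + 1) s1" "sound s1" "nmem s1 ''i'' 0 = i" "nmem s1 ''j'' 0 = j"
      "nmem s1 ''i2'' 0 = i" "nmem s1 ''j2'' 0 = j"
    using s ij by (simp_all add: s1_def)
  note e1 = try_edge[OF this lt lt, folded t1_def]
  have 2: "tables (2 * n + 1) s2" "sound s2" "nmem s2 ''i'' 0 = i" "nmem s2 ''j'' 0 = j"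
      "nmem s2 ''i2'' 0 = ?ni" "nmem s2 ''j2'' 0 = j"
    using e1 ij by (simp_all add: s2_def s1_def)
  note e2 = try_edge[OF 2 lt n(1) lt(2), folded t2_def]
  have 3: "tables (2 * n + 1) s3" "sound s3" "nmem s3 ''i'' 0 = i" "nmem s3 ''j'' 0 = j"
      "nmem s3 ''i2'' 0 = ?ni" "nmem s3 ''j2'' 0 = ?nj"
    using e2 2 by (simp_all add: s3_def)
  note e3 = try_edge[OF 3 lt n, folded t3_def]
  have 4: "tables (2 * n + 1) s4" "sound s4" "nmem s4 ''i'' 0 = i" "nmem s4 ''j'' 0 = j"
      "nmem s4 ''i2'' 0 = i" "nmem s4 ''j2'' 0 = ?nj"
    using e3 3 by (simp_all add: s4_def)
  note e4 = try_edge[OF 4 lt lt(1) n(2)]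
  have nx: "nmem t1 ''next'' = nmem s ''next''" "nmem t2 ''next'' = nmem s ''next''"
    "nmem t3 ''next'' = nmem s ''next''"
    using e1(1) e2(1) e3(1) by (simp_all add: s1_def s2_def s3_def)
  have ii: "nmem t1 ''i'' 0 = i" "nmem t2 ''j'' 0 = j" "nmem t3 ''i'' 0 = i"
    using e1(1) e2(1) e3(1) 2 3 ij by (simp_all add: s1_def s2_def s3_def)
  have s': "s' = step try_edge s4"
    by (simp add: s'_def try_edges_def ij s4_def t3_def[symmetric] s3_def[symmetric] t2_def[symmetric]
      s2_def[symmetric] t1_def[symmetric] s1_def[symmetric] nx ii)
  show "tables (2 * n + 1) s'" "sound s'" "nmem s' ''i'' 0 = i" "nmem s' ''j'' 0 = j"
    using e4(1,2,3) 4 by (simp_all add: s')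
  show nx': "nmem s' ''next'' = nmem s ''next''"
    using e4(1) nx by (simp add: s' s4_def)
  have le: "rmem s ''v'' 0 \<le> rmem t1 ''v'' 0" "rmem t1 ''v'' 0 \<le> rmem t2 ''v'' 0"
    "rmem t2 ''v'' 0 \<le> rmem t3 ''v'' 0" "rmem t3 ''v'' 0 \<le> rmem s' ''v'' 0"
    using e1(4) e2(4) e3(4) e4(4) by (simp_all add: s1_def s2_def s3_def s4_def s')
  then show "rmem s ''v'' 0 \<le> rmem s' ''v'' 0" by linarith
  show "covered s' i j"
    unfolding covered_def Let_def nx'
    using edge_ok_mono[OF e1(5)] edge_ok_mono[OF e2(5)] edge_ok_mono[OF e3(5)] e4(5) le by (simp add: s')
qed

definition search_inv :: "nat \<Rightarrow> nat \<Rightarrow> state \<Rightarrow> bool" where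
  "search_inv i j s \<longleftrightarrow> tables (2 * n + 1) s \<and> sound s \<and>
     (\<forall>i' < i. \<forall>j' < 2 * n + 1. covered s i' j') \<and> (\<forall>j' < j. covered s i j')"

definition optimal :: "state \<Rightarrow> bool" where
  "optimal s \<longleftrightarrow> input s \<and> arec_solution n p k x clo chi \<Gamma>
     (worst_scenario (rmem s ''a'' 0) (rmem s ''b'' 0)) (rmem s ''v'' 0)"

lemma search_inv_final:
  assumes "search_inv (2 * n + 1) 0 s"
  shows "optimal s"
proof -
  have s: "tables (2 * n + 1) s" "sound s" "\<And>i j. i < 2 * n + 1 \<Longrightarrow> j < 2 * n + 1 \<Longrightarrow> covered s i j"
    using assms by (auto simp: search_inv_def)
  have "bound a b \<le> rmem s ''v'' 0" if "0 \<le> b" "b \<le> a" "i \<in> {1..n}" "a \<le> chi i" for a b i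
  proof (rule bound_le_if_edges_ok)
    show "is_next l (nmem s ''next'' l)" if "l < 2 * n + 1" for l
      using s(1) that by (simp add: tables_def)
    \<comment> \<open>\<open>chi i\<close> is itself a breakpoint, with index \<open>n + i\<close>,
      and bounds \<open>a\<close> from above.\<close>
    show "n + i < 2 * n + 1" "a \<le> node (n + i)"
      using that cost_is_node by auto
  qed (use s(3) that in \<open>auto simp: covered_def Let_def\<close>)
  then show ?thesis
    using s(1,2) by (auto simp: optimal_def sound_def dest: tablesD intro: arec_solution_if_bound_maximal)
qed

lemma search: "triple (2 * n + 1) (tables (2 * n + 1)) search optimal"
proof -
  have inv_i: "search_inv i j (nwrite ''i'' l m s) = search_inv i j s"
    "search_inv i j (nwrite ''j'' l m s) = search_inv i j s" for i j l m s
    by (simp_all add: search_inv_def)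
  have inv_n: "nmem s ''n'' 0 = n" if "search_inv i j s" for i j s
    using that by (intro inputD) (auto simp: search_inv_def dest: tablesD)
  have "triple (2 * n + 1) (tables (2 * n + 1)) search (search_inv (2 * n + 1) 0)"
    unfolding search_def
  proof (rule triple_Seq)
    show "triple (2 * n + 1) (tables (2 * n + 1))
      (rset ''v'' (RNat (NConst 0)) ;; rset ''a'' (RNat (NConst 0)) ;; rset ''b'' (RNat (NConst 0)))
      (search_inv 0 0)"
    proof (rule triple_step)
      \<comment> \<open>At price 0 no cost lies below its level, so all hinges vanish and the
        initial value 0 is certified.\<close>
      have "bound 0 0 \<ge> 0"
        using \<Gamma>_nonneg costs by (force simp: bound_def dual_eq level_def intro!: sum_nonpos)
      then show "search_inv 0 0 (step (rset ''v'' (RNat (NConst 0)) ;; rset ''a'' (RNat (NConst 0)) ;;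
          rset ''b'' (RNat (NConst 0))) s)" if "tables (2 * n + 1) s" for s
        using that by (simp add: search_inv_def sound_def)
    qed simp
    show "triple (2 * n + 1) (search_inv 0 0)
      (for_loop ''i'' node_count (for_loop ''j'' node_count try_edges)) (search_inv (2 * n + 1) 0)"
    proof (rule triple_for_loop[where I = "\<lambda>i. search_inv i 0"])
      fix i assume i: "i < 2 * n + 1"
      have "triple (2 * n + 1) (\<lambda>s. search_inv i 0 s \<and> nmem s ''i'' 0 = i)
        (for_loop ''j'' node_count try_edges) (\<lambda>s. search_inv i (2 * n + 1) s \<and> nmem s ''i'' 0 = i)"
      proof (rule triple_for_loop[where I = "\<lambda>j s. search_inv i j s \<and> nmem s ''i'' 0 = i"])
        fix j assume j: "j < 2 * n + 1"
        show "triple (2 * n + 1) (\<lambda>s. (search_inv i j s \<and> nmem s ''i'' 0 = i) \<and> nmem s ''j'' 0 = j) try_edges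
          (\<lambda>s. (search_inv i (Suc j) s \<and> nmem s ''i'' 0 = i) \<and> nmem s ''j'' 0 = j)"
        proof (rule triple_step)
          fix s assume s: "(search_inv i j s \<and> nmem s ''i'' 0 = i) \<and> nmem s ''j'' 0 = j"
          then have "tables (2 * n + 1) s" "sound s" "nmem s ''i'' 0 = i" "nmem s ''j'' 0 = j"
            by (auto simp: search_inv_def)
          note t = try_edges[OF this i j]
          show "(search_inv i (Suc j) (step try_edges s) \<and> nmem (step try_edges s) ''i'' 0 = i) \<and>
              nmem (step try_edges s) ''j'' 0 = j"
            using s t covered_mono[OF _ t(6,5)] by (auto simp: search_inv_def less_Suc_eq)
        qed (simp add: try_edges_def try_edge_def eval_edge_def)
      qed (auto simp: inv_i inv_n)
      then show "triple (2 * n + 1) (\<lambda>s. search_inv i 0 s \<and> nmem s ''i'' 0 = i)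
        (for_loop ''j'' node_count try_edges) (\<lambda>s. search_inv (Suc i) 0 s \<and> nmem s ''i'' 0 = i)"
        by (rule triple_mono) (auto simp: search_inv_def less_Suc_eq)
    qed (auto simp: inv_i inv_n)
  qed
  then show ?thesis by (rule triple_mono) (auto intro: search_inv_final)
qed

section \<open>Correctness of the output\<close>

definition raised :: "nat \<Rightarrow> state \<Rightarrow> bool" where
  "raised m s \<longleftrightarrow> optimal s \<and>
     (\<forall>l. 1 \<le> l \<and> l \<le> m \<longrightarrow> rmem s ''c'' l = raise (rmem s ''a'' 0) (rmem s ''b'' 0) l) \<and>
     rmem s ''W'' 0 = (\<Sum>l=1..m. raise (rmem s ''a'' 0) (rmem s ''b'' 0) l)"

definition scaled :: "nat \<Rightarrow> state \<Rightarrow> bool" where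
  "scaled m s \<longleftrightarrow> (let a = rmem s ''a'' 0; b = rmem s ''b'' 0 in
     optimal s \<and> rmem s ''r'' 0 = scale a b \<and>
     (\<forall>l. 1 \<le> l \<and> l \<le> n \<longrightarrow>
       rmem s ''c'' l = (if l \<le> m then clo l + scale a b * raise a b l else raise a b l)))"

lemma optimal_nwrite [simp]:
  "a \<notin> {''n'', ''p'', ''k'', ''x''} \<Longrightarrow> optimal (nwrite a i m s) \<longleftrightarrow> optimal s"
  by (simp add: optimal_def)

lemma optimal_rwrite [simp]:
  "a \<notin> {''Gamma'', ''clo'', ''chi'', ''a'', ''b'', ''v''} \<Longrightarrow> optimal (rwrite a i r s) \<longleftrightarrow> optimal s"
  by (auto simp: optimal_def)

lemma optimalD: "optimal s \<Longrightarrow> input s"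
  by (simp add: optimal_def)

lemma raise_item:
  assumes "m < n"
  shows "triple N (\<lambda>s. raised m s \<and> nmem s ''i'' 0 = m) raise_item
    (\<lambda>s. raised (Suc m) s \<and> nmem s ''i'' 0 = m)"
proof (rule triple_step)
  fix s assume s: "raised m s \<and> nmem s ''i'' 0 = m"
  then have inp: "input s" by (auto simp: raised_def dest: optimalD)
  let ?a = "rmem s ''a'' 0" and ?b = "rmem s ''b'' 0"
  have "clo (Suc m) \<le> chi (Suc m)" "x (Suc m) = 0 \<or> x (Suc m) = 1"
    using assms costs x_cases by auto
  then have w: "raise ?a ?b (Suc m) = (let t = if 0 < x (Suc m) then ?a else ?b in
      if clo (Suc m) < t then if chi (Suc m) < t then chi (Suc m) - clo (Suc m) else t - clo (Suc m) else 0)"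
    by (auto simp: raise_def level_def Let_def)
  show "raised (Suc m) (step raise_item s) \<and> nmem (step raise_item s) ''i'' 0 = m"
    using s assms by (auto simp: raised_def raise_item_def inputD[OF inp] w Let_def le_Suc_eq)
qed (simp add: raise_item_def)

lemma output_scenario:
  "triple (2 * n + 1) optimal output_scenario
    (\<lambda>s. arec_solution n p k x clo chi \<Gamma> (\<lambda>i\<in>{1..n}. rmem s ''c'' i) (rmem s ''v'' 0))"
proof -
  have "triple (2 * n + 1) optimal output_scenario (scaled n)"
    unfolding output_scenario_def
  proof (intro triple_Seq)
    show "triple (2 * n + 1) optimal (rset ''W'' (RNat (NConst 0))) (raised 0)"
      by (rule triple_step) (auto simp: raised_def)
    show "triple (2 * n + 1) (raised 0) (for_loop ''i'' (nvar ''n'') raise_item) (raised n)"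
      by (rule triple_for_loop; (rule raise_item, assumption)?)
        (auto simp: raised_def inputD(1)[OF optimalD])
    show "triple (2 * n + 1) (raised n)
      (If (RLess (rvar ''Gamma'') (rvar ''W'')) (rset ''r'' (RDiv (rvar ''Gamma'') (rvar ''W'')))
        (rset ''r'' (RNat (NConst 1)))) (scaled 0)"
      by (rule triple_step) (auto simp: raised_def scaled_def Let_def scale_def inputD(4)[OF optimalD])
    show "triple (2 * n + 1) (scaled 0) (for_loop ''i'' (nvar ''n'')
       (RStore ''c'' item (RAdd (RLoad ''clo'' item) (RMul (rvar ''r'') (RLoad ''c'' item))))) (scaled n)"
      by (rule triple_for_loop; (rule triple_step)?)
        (auto simp: scaled_def Let_def inputD[OF optimalD] le_Suc_eq)
  qed
  moreover have "arec_solution n p k x clo chi \<Gamma> (\<lambda>i\<in>{1..n}. rmem s ''c'' i) (rmem s ''v'' 0)"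
    if "scaled n s" for s
  proof -
    have "(\<lambda>i\<in>{1..n}. rmem s ''c'' i) = worst_scenario (rmem s ''a'' 0) (rmem s ''b'' 0)"
      using that by (auto simp: scaled_def Let_def worst_scenario_def fun_eq_iff restrict_def)
    then show ?thesis using that by (simp add: scaled_def Let_def optimal_def)
  qed
  ultimately show ?thesis by (auto elim: triple_mono)
qed

lemma arec_program:
  "triple (2 * n + 1) input arec_program
    (\<lambda>s. arec_solution n p k x clo chi \<Gamma> (\<lambda>i\<in>{1..n}. rmem s ''c'' i) (rmem s ''v'' 0))"
  unfolding arec_program_def
  by (intro triple_Seq) (rule fill_nodes fill_tables search output_scenario)+

end

section \<open>Running time\<close>

lemma loop_depth_arec_program: "loop_depth arec_program = 2"
  by (simp add: arec_program_def fill_nodes_def fill_tables_def init_entry_def entry_item_def subtract_hinge_def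
    entry_next_def store_entry_def search_def try_edges_def try_edge_def eval_edge_def output_scenario_def raise_item_def)

theorem theorem5:
  shows "\<exists>prog T. solves_arec_in_time prog T \<and>
           (\<lambda>n. real (T n)) \<in> O(\<lambda>n. (real n)\<^sup>2)"
proof (intro exI conjI)
  let ?T = "\<lambda>n. cost_bound (2 * n + 1) arec_program"
  show "solves_arec_in_time arec_program ?T"
    unfolding solves_arec_in_time_def
  proof (intro allI impI)
    fix n p k x clo chi \<Gamma> assume "arec_instance n p k x clo chi \<Gamma>"
    then interpret arec n p k x clo chi \<Gamma> by unfold_locales
    from arec_program input_arec_input
    show "\<exists>t s. exec arec_program (arec_input n p k x clo chi \<Gamma>) t s \<and> t \<le> ?T n \<and>
        arec_solution n p k x clo chi \<Gamma> (\<lambda>i\<in>{1..n}. rmem s ''c'' i) (rmem s ''v'' 0)"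
      by (rule tripleE) blast
  qed
  \<comment> \<open>Loop depth two and at most \<open>2 * n + 1\<close> iterations per loop give the
    factor \<open>(2 * n + 2)^2\<close>, which is at most \<open>(4 * n)^2\<close> for positive
    \<open>n\<close>; hence the 16.\<close>
  let ?K = "cost_bound 0 arec_program * 16"
  have "?T n \<le> ?K * n ^ 2" if "1 \<le> n" for n
  proof -
    have "?T n \<le> cost_bound 0 arec_program * (2 * n + 1 + 1) ^ 2"
      using cost_bound_poly[of "2 * n + 1" arec_program] by (simp only: loop_depth_arec_program)
    also have "\<dots> \<le> cost_bound 0 arec_program * (4 * n) ^ 2"
      using that by (intro mult_left_mono power_mono) auto
    finally show ?thesis by (simp add: power_mult_distrib)
  qed
  then have "real (?T n) \<le> real ?K * real n ^ 2" if "1 \<le> n" for n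
    using that by (metis of_nat_le_iff of_nat_mult of_nat_power)
  then show "(\<lambda>n. real (?T n)) \<in> O(\<lambda>n. (real n)\<^sup>2)"
    by (intro bigoI[of _ "real ?K"] eventually_sequentiallyI[of 1]) simp
qed

end
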